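(* Let $(\Omega,\mathcal{F},\mathbb{P})$ be a probability space and let $X_t$, $t\in[0,+\infty)$, be a real process on it which is self-similar with index $\beta>0$, has stationary increments and has càdlàg trajectories. Assume additionally that for some $c_0>0$ $$\mathbb{E}\,\mathrm{TV}^{c_0}(X,[0,1])<+\infty,$$ and that for any $k\in\{1,2,3,\dots\}$ the stationary sequence $$\left(\mathrm{TV}^{1}(X,[0,k]),\ \mathrm{TV}^{1}(X,[k,2k]),\ \mathrm{TV}^{1}(X,[2k,3k]),\ \ldots\right)$$ is ergodic. Then there exists $C\in(0,+\infty)$ such that for each $t\in[0,+\infty)$ $$c^{1/\beta-1}\,\mathrm{TV}^{c}(X,[0,t])\to C\cdot t\quad\text{in probability as } c\to 0+.$$
   Context: Truncated variation: for $x:[0,+\infty)\to\mathbb{R}$, $c\ge 0$ and $0\le s<t<+\infty$, $$\mathrm{TV}^{c}(x,[s,t])=\sup_{\pi}\sum_{[u,v]\in\pi}\max(|x_v-x_u|-c,0),$$ the supremum being over all finite partitions $\pi$ of $[s,t]$, that is, finite sets of subintervals $[u,v]$ of $[s,t]$ with disjoint interiors whose union is $[s,t]$ (on the degenerate interval $[0,0]$ it is $0$). $X$ is self-similar with index $\beta>0$ if for any $A>0$ the processes $(A^{-\beta}X_{At})_{t\ge 0}$ and $(X_t)_{t\ge 0}$ have the same distribution. $X$ has stationary increments if for all $0\le t_1<t_2<\dots<t_n$ and $h>0$ the vectors $(X_{t_2}-X_{t_1},X_{t_3}-X_{t_2},\dots,X_{t_n}-X_{t_{n-1}})$ and $(X_{t_2+h}-X_{t_1+h},X_{t_3+h}-X_{t_2+h},\dots,X_{t_n+h}-X_{t_{n-1}+h})$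 have the same distribution. Càdlàg means right-continuous with left limits.
   Formalization: The formal theorem additionally assumes that X is not almost surely the identically zero process; for X = 0 every hypothesis holds but the limit is 0, so no C > 0 exists. *)

theory Defs
  imports "HOL-Probability.Probability"
begin

text \<open>
  The supremum is taken in \<^typ>\<open>ennreal\<close>, since it may be infinite for a general path.
  The library's \<^const>\<open>division_of\<close> is the notion of a finite set of closed subintervals with
  disjoint interiors covering the whole interval; its members \<open>I = [u, v]\<close> have
  \<open>u = Inf I\<close> and \<open>v = Sup I\<close>. It also admits one-point members, which contribute
  \<open>max (0 - c) 0 = 0\<close> for \<open>c \<ge> 0\<close>.
\<close>

definition truncated_variation :: "real \<Rightarrow> (real \<Rightarrow> real) \<Rightarrow> real \<Rightarrow> real \<Rightarrow> ennreal" where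
  "truncated_variation c x s t =
     (SUP \<pi>\<in>{\<pi>. \<pi> division_of {s..t}}.
        \<Sum>I\<in>\<pi>. ennreal (max (\<bar>x (Sup I) - x (Inf I)\<bar> - c) 0))"

definition cadlag :: "(real \<Rightarrow> real) \<Rightarrow> bool" where
  "cadlag x \<longleftrightarrow>
     (\<forall>t\<ge>0. (x \<longlongrightarrow> x t) (at_right t)) \<and> (\<forall>t>0. \<exists>l. (x \<longlongrightarrow> l) (at_left t))"

text \<open>
  A process is a family \<open>X t\<close> indexed by \<open>t \<in> [0, \<infinity>)\<close>; values at negative times are never used.
  Its distribution is its law on the product \<open>\<sigma>\<close>-algebra of \<open>\<real>\<^bsup>[0, \<infinity>)\<^esup>\<close>.
\<close>

definition self_similar :: "'a measure \<Rightarrow> real \<Rightarrow> (real \<Rightarrow> 'a \<Rightarrow> real) \<Rightarrow> bool" where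
  "self_similar M \<beta> X \<longleftrightarrow>
     (\<forall>A>0. distr M (\<Pi>\<^sub>M t\<in>{0..}. borel) (\<lambda>\<omega>. \<lambda>t\<in>{0..}. A powr (- \<beta>) * X (A * t) \<omega>)
          = distr M (\<Pi>\<^sub>M t\<in>{0..}. borel) (\<lambda>\<omega>. \<lambda>t\<in>{0..}. X t \<omega>))"

definition stationary_increments :: "'a measure \<Rightarrow> (real \<Rightarrow> 'a \<Rightarrow> real) \<Rightarrow> bool" where
  "stationary_increments M X \<longleftrightarrow>
     (\<forall>(n::nat) (t :: nat \<Rightarrow> real) h. 0 \<le> t 1 \<and> strict_mono_on {1..n} t \<and> 0 < h \<longrightarrow>
        distr M (\<Pi>\<^sub>M i\<in>{1..<n}. borel) (\<lambda>\<omega>. \<lambda>i\<in>{1..<n}. X (t (i + 1)) \<omega> - X (t i) \<omega>)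
      = distr M (\<Pi>\<^sub>M i\<in>{1..<n}. borel) (\<lambda>\<omega>. \<lambda>i\<in>{1..<n}. X (t (i + 1) + h) \<omega> - X (t i + h) \<omega>))"

text \<open>
  Ergodicity of a stationary sequence: shift-invariant measurable sets of the path space have
  probability 0 or 1. Stationarity itself is not part of the definition.
\<close>

definition ergodic_seq :: "'a measure \<Rightarrow> (nat \<Rightarrow> 'a \<Rightarrow> 'b::topological_space) \<Rightarrow> bool" where
  "ergodic_seq M Y \<longleftrightarrow>
     (\<forall>B \<in> sets (\<Pi>\<^sub>M n\<in>(UNIV :: nat set). borel).
        (\<lambda>y n. y (Suc n)) -` B = B \<longrightarrow>
          measure M {\<omega> \<in> space M. (\<lambda>n. Y n \<omega>) \<in> B} \<in> {0, 1})"

text \<open>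
  Convergence in probability to a real constant, for extended real random variables; a
  value \<open>\<plusminus>\<infinity>\<close> lies at infinite distance from the limit.
\<close>

definition tendsto_in_probability ::
  "'a measure \<Rightarrow> ('i \<Rightarrow> 'a \<Rightarrow> ereal) \<Rightarrow> real \<Rightarrow> 'i filter \<Rightarrow> bool" where
  "tendsto_in_probability M Y l F \<longleftrightarrow>
     (\<forall>\<epsilon>>0. ((\<lambda>i. measure M {\<omega> \<in> space M. \<bar>Y i \<omega> - ereal l\<bar> > ereal \<epsilon>}) \<longlongrightarrow> 0) F)"

end

theory Submission
  imports Defs "HOL-Real_Asymp.Real_Asymp"
begin

text \<open>
  By self-similarity, \<open>c\<^bsup>1/\<beta> - 1\<^esup> TV\<^sup>c(X, [0, t])\<close> has the law of \<open>TV\<^sup>1(X, [0, A t]) / A\<close> with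
  \<open>A = c\<^bsup>-1/\<beta>\<^esup>\<close>, so it suffices that \<open>TV\<^sup>1(X, [0, T]) / T \<longrightarrow> C\<close> almost surely as \<open>T \<longrightarrow> \<infinity>\<close>.
  Cutting an interval at a point changes \<open>TV\<^sup>1\<close> by at most 1, so \<open>TV\<^sup>1(X, [0, n k])\<close> differs by at
  most \<open>n\<close> from the sum over the blocks \<open>[i k, (i + 1) k]\<close>, \<open>i < n\<close>. The ergodic theorem applied to
  these blocks determines the limit up to an error \<open>1 / k\<close>, and \<open>k\<close> is arbitrary. If \<open>C\<close> were 0,
  then almost surely all increments of \<open>X\<close> would be bounded by 1, and by self-similarity \<open>X = 0\<close>.
\<close>

section \<open>The pointwise ergodic theorem\<close>

text \<open>Three obstacles shape the argument. Self-similarity and stationarity are equalities of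
  laws on a product \<sigma>-algebra, whose sets depend on countably many coordinates, while the
  truncated variation is a supremum over uncountably many partitions. Right continuity reduces it to
  partition points in \<rat> \<union> {t}, and only in that form do equalities of laws pass to it.
  Ergodicity is assumed for the law of each block sequence, not for a flow on the probability space;
  so the ergodic theorem is applied to the shift on sequences in [0, \<infinity>], once for each
  block length k. Finally, the scaling factor A changes with c, so the scaling identity holds in law
  for each c separately: almost sure convergence at large times becomes convergence in probability
  for small c. The constant C is found from means alone. If m k is the mean of TV^1 over [0, k],
  then j * m k \<le> m (j * k) \<le> j * m k + j, and this forces a single C with m k \<le> k * C
  \<le> m k + 1 for all k \<ge> 1.\<close>

locale measure_preserving = prob_space +
  fixes T :: "'a \<Rightarrow> 'a"
  assumes T_measurable [measurable]: "T \<in> measurable M M"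
    and distr_T: "distr M M T = M"
begin

lemma integrable_comp_T:
  fixes g :: "'a \<Rightarrow> real"
  assumes "integrable M g"
  shows "integrable M (\<lambda>x. g (T x))" "(\<integral>x. g (T x) \<partial>M) = (\<integral>x. g x \<partial>M)"
proof -
  have [measurable]: "g \<in> borel_measurable M"
    using assms by simp
  have "integrable (distr M M T) g"
    using assms by (simp add: distr_T)
  then show "integrable M (\<lambda>x. g (T x))"
    by (subst (asm) integrable_distr_eq) simp_all
  have "(\<integral>x. g x \<partial>distr M M T) = (\<integral>x. g (T x) \<partial>M)"
    by (rule integral_distr) simp_all
  then show "(\<integral>x. g (T x) \<partial>M) = (\<integral>x. g x \<partial>M)"
    by (simp add: distr_T)
qed

text \<open>\<open>max_birkhoff_sum g n x\<close> is the maximum of the Birkhoff sums of lengths \<open>1, \<dots>, n + 1\<close>.\<close>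

fun max_birkhoff_sum :: "('a \<Rightarrow> real) \<Rightarrow> nat \<Rightarrow> 'a \<Rightarrow> real" where
  "max_birkhoff_sum g 0 x = g x"
| "max_birkhoff_sum g (Suc n) x = g x + max 0 (max_birkhoff_sum g n (T x))"

lemma birkhoff_sum_le_max: "(\<Sum>i<Suc n. g ((T ^^ i) x)) \<le> max_birkhoff_sum g n x"
proof (induction n arbitrary: x)
  case (Suc n)
  have "(\<Sum>i<Suc (Suc n). g ((T ^^ i) x)) = g x + (\<Sum>i<Suc n. g ((T ^^ i) (T x)))"
    by (subst sum.lessThan_Suc_shift) (simp add: funpow_swap1)
  also have "\<dots> \<le> g x + max_birkhoff_sum g n (T x)"
    using Suc by simp
  finally show ?case by simp
qed simp

lemma max_birkhoff_sum_Suc_ge: "max_birkhoff_sum g n x \<le> max_birkhoff_sum g (Suc n) x"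
  by (induction n arbitrary: x) (simp_all, smt (verit))

lemma max_birkhoff_sum_mono: "m \<le> n \<Longrightarrow> max_birkhoff_sum g m x \<le> max_birkhoff_sum g n x"
  by (rule lift_Suc_mono_le[of "\<lambda>n. max_birkhoff_sum g n x"]) (rule max_birkhoff_sum_Suc_ge)

lemma integrable_max_birkhoff_sum:
  "integrable M g \<Longrightarrow> integrable M (max_birkhoff_sum g n)"
proof (induction n)
  case 0
  have "max_birkhoff_sum g 0 = g" by (rule ext) simp
  with 0 show ?case by (simp only:)
next
  case (Suc n)
  note Suc_T = integrable_comp_T(1)[OF Suc.IH[OF Suc.prems]]
  have "max_birkhoff_sum g (Suc n) = (\<lambda>x. g x + max 0 (max_birkhoff_sum g n (T x)))"
    by (rule ext) simp
  moreover have "integrable M (\<lambda>x. g x + max 0 (max_birkhoff_sum g n (T x)))"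
    by (rule Bochner_Integration.integrable_add[OF Suc.prems integrable_max[OF integrable_zero Suc_T]])
  ultimately show ?case by (simp only:)
qed

end

locale ergodic = measure_preserving +
  assumes invariant_trivial: "B \<in> sets M \<Longrightarrow> T -` B \<inter> space M = B \<Longrightarrow> measure M B \<in> {0, 1}"
begin

text \<open>
  On the invariant set where the maximal sums are unbounded, \<open>max_birkhoff_sum g (Suc n) x -
  max_birkhoff_sum g n (T x)\<close> decreases to \<open>g x\<close>, while its integral is nonnegative because \<open>T\<close>
  preserves the measure. So \<open>g\<close> has nonnegative integral over this set.
\<close>

lemma AE_birkhoff_sum_bounded_above:
  fixes g :: "'a \<Rightarrow> real"
  assumes g: "integrable M g" and neg: "(\<integral>x. g x \<partial>M) < 0"
  shows "AE x in M. \<exists>b. \<forall>n. (\<Sum>i<n. g ((T ^^ i) x)) \<le> b"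
proof -
  let ?\<Phi> = "max_birkhoff_sum g"
  define E where "E = {x \<in> space M. \<forall>b::nat. \<exists>n. ?\<Phi> n x > real b}"
  have g_meas [measurable]: "g \<in> borel_measurable M"
    using g by simp
  have \<Phi>_meas [measurable]: "?\<Phi> n \<in> borel_measurable M" for n
    using integrable_max_birkhoff_sum[OF g] by simp
  have E_sets [measurable]: "E \<in> sets M"
    unfolding E_def by measurable
  have E_unbounded: "\<exists>n. ?\<Phi> n x > b" if "x \<in> E" for x b
  proof -
    obtain k :: nat where "b < real k" using reals_Archimedean2 by blast
    moreover obtain n where "real k < ?\<Phi> n x" using \<open>x \<in> E\<close> by (auto simp: E_def)
    ultimately show ?thesis by (meson less_trans)
  qed
  have E_T: "T x \<in> E \<longleftrightarrow> x \<in> E" if x: "x \<in> space M" for x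
  proof
    assume Tx: "T x \<in> E"
    have "\<exists>n. ?\<Phi> n x > real b" for b
    proof -
      obtain n where "?\<Phi> n (T x) > real b - g x" using E_unbounded[OF Tx] by blast
      then have "?\<Phi> (Suc n) x > real b" by simp
      then show ?thesis by blast
    qed
    then show "x \<in> E" using x by (auto simp: E_def)
  next
    assume xE: "x \<in> E"
    have "\<exists>n. ?\<Phi> n (T x) > real b" for b
    proof -
      \<comment> \<open>The margin |g x| absorbs the first summand: one step further, the maximum
        with 0 exceeds \<open>real b\<close>, which is nonnegative, so it is attained by
        \<open>?\<Phi> n (T x)\<close>.\<close>
      obtain n where "?\<Phi> n x > real b + \<bar>g x\<bar>" using E_unbounded[OF xE] by blast
      then have "?\<Phi> (Suc n) x > real b + \<bar>g x\<bar>"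
        using max_birkhoff_sum_Suc_ge[of g n x] by linarith
      then have "?\<Phi> n (T x) > real b" by (simp add: max_def split: if_splits)
      then show ?thesis by blast
    qed
    then show "T x \<in> E" using x measurable_space[OF T_measurable] by (auto simp: E_def)
  qed
  have "T -` E \<inter> space M = E"
    using E_T by (auto simp: E_def)
  then have E01: "measure M E \<in> {0, 1}"
    by (rule invariant_trivial[OF E_sets])
  define D where "D n x = indicator E x * (?\<Phi> (Suc n) x - ?\<Phi> n (T x))" for n x
  have int_\<Phi>: "integrable M (\<lambda>x. indicator E x * ?\<Phi> n x)" for n
    using integrable_mult_indicator[OF E_sets integrable_max_birkhoff_sum[OF g, of n]] by simp
  \<comment> \<open>By \<open>E_T\<close> the indicator may be evaluated at \<open>T x\<close>
    instead of x; measure preservation then removes \<open>T\<close> from the integral.\<close>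
  have shift: "integrable M (\<lambda>x. indicator E x * ?\<Phi> n (T x))"
    "(\<integral>x. indicator E x * ?\<Phi> n (T x) \<partial>M) = (\<integral>x. indicator E x * ?\<Phi> n x \<partial>M)" for n
  proof -
    have eq: "indicator E (T x) * ?\<Phi> n (T x) = indicator E x * ?\<Phi> n (T x)" if "x \<in> space M" for x
      using E_T[OF that] by (simp add: indicator_def)
    show "integrable M (\<lambda>x. indicator E x * ?\<Phi> n (T x))"
      using integrable_comp_T(1)[OF int_\<Phi>[of n]] by (subst (asm) Bochner_Integration.integrable_cong[OF refl eq])
    show "(\<integral>x. indicator E x * ?\<Phi> n (T x) \<partial>M) = (\<integral>x. indicator E x * ?\<Phi> n x \<partial>M)"
      using integrable_comp_T(2)[OF int_\<Phi>[of n]] by (subst (asm) Bochner_Integration.integral_cong[OF refl eq])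
  qed
  have D_nonneg: "0 \<le> (\<integral>x. D n x \<partial>M)" for n
  proof -
    have "(\<integral>x. D n x \<partial>M)
        = (\<integral>x. indicator E x * ?\<Phi> (Suc n) x \<partial>M) - (\<integral>x. indicator E x * ?\<Phi> n (T x) \<partial>M)"
      unfolding D_def right_diff_distrib
      by (rule Bochner_Integration.integral_diff[OF int_\<Phi> shift(1)])
    moreover have "(\<integral>x. indicator E x * ?\<Phi> n x \<partial>M) \<le> (\<integral>x. indicator E x * ?\<Phi> (Suc n) x \<partial>M)"
      by (intro integral_mono int_\<Phi> mult_left_mono max_birkhoff_sum_Suc_ge) simp
    ultimately show ?thesis using shift(2) by simp
  qed
  have "(\<lambda>n. \<integral>x. D n x \<partial>M) \<longlonglongrightarrow> (\<integral>x. indicator E x * g x \<partial>M)"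
  proof (rule integral_dominated_convergence)
    show "(\<lambda>x. indicator E x * g x) \<in> borel_measurable M" by simp
    show "D n \<in> borel_measurable M" for n unfolding D_def by measurable
    show "integrable M (\<lambda>x. \<bar>g x\<bar> + \<bar>g (T x)\<bar>)"
      using g integrable_comp_T(1)[OF g] by simp
    \<comment> \<open>On \<open>E\<close> the value of \<open>D n x\<close> is g x + max 0 (-
      \<open>?\<Phi> n (T x)\<close>), and \<open>?\<Phi> n (T x)\<close> \<ge> g (T x) bounds the
      second summand by |g (T x)|.\<close>
    show "AE x in M. norm (D n x) \<le> \<bar>g x\<bar> + \<bar>g (T x)\<bar>" for n
    proof (rule AE_I2)
      fix x assume "x \<in> space M"
      have "g (T x) \<le> ?\<Phi> n (T x)"
        using max_birkhoff_sum_mono[of 0 n g "T x"] by simp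
      then show "norm (D n x) \<le> \<bar>g x\<bar> + \<bar>g (T x)\<bar>"
        unfolding D_def by (auto simp: indicator_def max_def abs_if)
    qed
    show "AE x in M. (\<lambda>n. D n x) \<longlonglongrightarrow> indicator E x * g x"
    proof (rule AE_I2)
      fix x assume x: "x \<in> space M"
      show "(\<lambda>n. D n x) \<longlonglongrightarrow> indicator E x * g x"
      proof (cases "x \<in> E")
        case True
        then obtain N where N: "?\<Phi> N (T x) > 0" using E_T[OF x] E_unbounded by blast
        have "D n x = g x" if "n \<ge> N" for n
          using max_birkhoff_sum_mono[OF that, of g "T x"] N True by (simp add: D_def)
        then have "\<forall>\<^sub>F n in sequentially. D n x = g x"
          by (auto simp: eventually_sequentially)
        then show ?thesis using True by (simp add: tendsto_eventually)
      qed (simp add: D_def)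
    qed
  qed
  then have E_nonneg: "0 \<le> (\<integral>x. indicator E x * g x \<partial>M)"
    by (rule LIMSEQ_le_const) (use D_nonneg in auto)
  have "measure M E \<noteq> 1"
  proof
    assume "measure M E = 1"
    then have "AE x in M. x \<in> E" by (simp add: prob_eq_1)
    then have "(\<integral>x. indicator E x * g x \<partial>M) = (\<integral>x. g x \<partial>M)"
      by (intro integral_cong_AE) auto
    then show False using E_nonneg neg by simp
  qed
  then have "AE x in M. x \<notin> E"
    using E01 by (simp add: prob_eq_0)
  then show ?thesis
  proof (rule AE_mp, intro AE_I2 impI)
    fix x assume "x \<in> space M" "x \<notin> E"
    then obtain b :: nat where b: "?\<Phi> n x \<le> real b" for n
      by (auto simp: E_def not_less)
    have "(\<Sum>i<n. g ((T ^^ i) x)) \<le> real b" for n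
      using birkhoff_sum_le_max[where n = "n - 1" and g = g and x = x] b[of "n - 1"] by (cases n) auto
    then show "\<exists>b. \<forall>n. (\<Sum>i<n. g ((T ^^ i) x)) \<le> b" by blast
  qed
qed

text \<open>After subtracting a constant slightly above the mean, the sums are bounded above by the
  previous lemma, and division by n removes the bound. Using only the constants mean + 1 / (j + 1)
  gives one null set that serves all real a.\<close>

lemma AE_birkhoff_average_eventually_less:
  fixes f :: "'a \<Rightarrow> real"
  assumes f: "integrable M f"
  shows "AE x in M. \<forall>a > (\<integral>x. f x \<partial>M). \<forall>\<^sub>F n in sequentially. (\<Sum>i<n. f ((T ^^ i) x)) / n < a"
proof -
  let ?m = "\<integral>x. f x \<partial>M"
  let ?c = "\<lambda>j::nat. ?m + inverse (real (Suc j))"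
  have "AE x in M. \<exists>b. \<forall>n. (\<Sum>i<n. f ((T ^^ i) x) - ?c j) \<le> b" for j
    by (rule AE_birkhoff_sum_bounded_above) (use f in \<open>auto simp: prob_space\<close>)
  then have "AE x in M. \<forall>j. \<exists>b. \<forall>n. (\<Sum>i<n. f ((T ^^ i) x) - ?c j) \<le> b"
    by (simp add: AE_all_countable)
  then show ?thesis
  proof (rule AE_mp, intro AE_I2 impI allI)
    fix x a assume bounded: "\<forall>j. \<exists>b. \<forall>n. (\<Sum>i<n. f ((T ^^ i) x) - ?c j) \<le> b" and "?m < a"
    then obtain j where j: "?c j < a"
      using reals_Archimedean[of "a - ?m"] by (auto simp: algebra_simps)
    obtain b where "(\<Sum>i<n. f ((T ^^ i) x) - ?c j) \<le> b" for n
      using bounded by blast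
    then have b: "(\<Sum>i<n. f ((T ^^ i) x)) \<le> b + n * ?c j" for n
      by (simp add: sum_subtractf algebra_simps)
    have "(\<lambda>n. b / real n + ?c j) \<longlonglongrightarrow> 0 + ?c j"
      by (intro tendsto_intros lim_const_over_n)
    then have "\<forall>\<^sub>F n in sequentially. b / real n + ?c j < a"
      using j by (simp add: order_tendsto_iff)
    with eventually_gt_at_top[of "0::nat"]
    show "\<forall>\<^sub>F n in sequentially. (\<Sum>i<n. f ((T ^^ i) x)) / n < a"
    proof eventually_elim
      case (elim n)
      then have "(\<Sum>i<n. f ((T ^^ i) x)) / n \<le> b / n + ?c j"
        using divide_right_mono[OF b[of n], of "real n"] by (simp add: add_divide_distrib)
      then show ?case using elim by linarith
    qed
  qed
qed

theorem birkhoff: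
  fixes f :: "'a \<Rightarrow> real"
  assumes f: "integrable M f"
  shows "AE x in M. (\<lambda>n. (\<Sum>i<n. f ((T ^^ i) x)) / n) \<longlonglongrightarrow> (\<integral>x. f x \<partial>M)"
  using AE_birkhoff_average_eventually_less[OF f]
    AE_birkhoff_average_eventually_less[OF integrable_minus[OF f]]
proof eventually_elim
  case (elim x)
  show ?case
  proof (rule order_tendstoI)
    fix a assume "a < (\<integral>x. f x \<partial>M)"
    then have "\<forall>\<^sub>F n in sequentially. (\<Sum>i<n. - f ((T ^^ i) x)) / n < - a"
      using elim(2) by simp
    then show "\<forall>\<^sub>F n in sequentially. a < (\<Sum>i<n. f ((T ^^ i) x)) / n"
      by (simp add: sum_negf)
  qed (use elim(1) in auto)
qed

end

section \<open>Truncated variation as a supremum over sorted lists\<close>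

fun increment_sum :: "real \<Rightarrow> (real \<Rightarrow> real) \<Rightarrow> real list \<Rightarrow> ennreal" where
  "increment_sum c x (u # v # us) = ennreal (max (\<bar>x v - x u\<bar> - c) 0) + increment_sum c x (v # us)"
| "increment_sum c x _ = 0"

lemma increment_sum_cong:
  "(\<And>u. u \<in> set us \<Longrightarrow> x u = y u) \<Longrightarrow> increment_sum c x us = increment_sum c y us"
  by (induction c x us rule: increment_sum.induct) auto

lemma increment_sum_map: "increment_sum c x (map f us) = increment_sum c (\<lambda>u. x (f u)) us"
  by (induction us rule: induct_list012) auto

lemma increment_sum_diff_const:
  "increment_sum c (\<lambda>u. x u - a) us = increment_sum c x us"
  by (induction us rule: induct_list012) auto

lemma increment_sum_scale:
  assumes "0 < a"
  shows "increment_sum c (\<lambda>u. a * x u) us = ennreal a * increment_sum (c / a) x us"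
proof (induction us rule: induct_list012)
  case (3 u v us)
  have "\<bar>a * x v - a * x u\<bar> = a * \<bar>x v - x u\<bar>"
    using assms by (simp add: abs_mult flip: right_diff_distrib)
  then have "max (\<bar>a * x v - a * x u\<bar> - c) 0 = a * max (\<bar>x v - x u\<bar> - c / a) 0"
    using assms by (simp add: max_def field_simps)
  then show ?case
    using 3 assms by (simp add: distrib_left ennreal_mult)
qed simp_all

lemma increment_sum_Cons_ge: "increment_sum c x us \<le> increment_sum c x (u # us)"
  by (cases us) simp_all

lemma increment_sum_append_ge:
  "increment_sum c x us + increment_sum c x vs \<le> increment_sum c x (us @ vs)"
proof (induction us rule: induct_list012)
  case (2 u)
  then show ?case by (simp add: increment_sum_Cons_ge)
next
  case (3 u v us)
  then show ?case by (simp add: add.assoc add_left_mono)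
qed simp

text \<open>Only the increment joining the two lists is affected. By the triangle inequality,
  replacing it by two increments through \<open>m\<close> loses at most one threshold
  \<open>c\<close>, wherever \<open>m\<close> lies.\<close>

lemma increment_sum_append_le:
  assumes "0 \<le> c"
  shows "increment_sum c x (us @ vs)
    \<le> increment_sum c x (us @ [m]) + increment_sum c x (m # vs) + ennreal c"
proof (induction us rule: induct_list012)
  case 1
  then show ?case by (simp add: increment_sum_Cons_ge add_increasing2)
next
  case (2 u)
  show ?case
  proof (cases vs)
    case (Cons v vs')
    have "ennreal (max (\<bar>x v - x u\<bar> - c) 0)
        \<le> ennreal (max (\<bar>x m - x u\<bar> - c) 0 + max (\<bar>x v - x m\<bar> - c) 0 + c)"
      by (intro ennreal_leI) linarith
    also have "\<dots> = ennreal (max (\<bar>x m - x u\<bar> - c) 0) + ennreal (max (\<bar>x v - x m\<bar> - c) 0) + ennreal c"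
      using assms by (simp add: ennreal_plus)
    finally show ?thesis
      using Cons by (simp add: add_ac add_right_mono)
  qed simp
next
  case (3 u v us)
  then show ?case by (simp add: add.assoc add_left_mono)
qed

definition sorted_lists :: "real set \<Rightarrow> real list set" where
  "sorted_lists D = {us. sorted us \<and> set us \<subseteq> D}"

text \<open>Used to split off the member of a division with the largest left endpoint.\<close>

lemma le_of_disjoint_interiors:
  fixes u v u' v' :: real
  assumes "u < v" "u' < v'" "interior {u..v} \<inter> interior {u'..v'} = {}" "u' \<le> u"
  shows "v' \<le> u"
proof (rule ccontr)
  assume "\<not> v' \<le> u"
  then have "(u + min v v') / 2 \<in> interior {u..v} \<inter> interior {u'..v'}"
    using assms by (auto simp: interior_atLeastAtMost_real min_def field_simps split: if_splits)
  then show False using assms(3) by auto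
qed

text \<open>Lists replace divisions because they allow list induction and can be mapped under time
  changes. They need not contain the endpoints and may repeat points: for c \<ge> 0 this leaves the
  supremum unchanged. The set \<open>D\<close> is arbitrary, so that it can be made
  countable.\<close>

definition list_variation :: "real \<Rightarrow> (real \<Rightarrow> real) \<Rightarrow> real set \<Rightarrow> ennreal" where
  "list_variation c x D = (SUP us\<in>sorted_lists D. increment_sum c x us)"

lemma Nil_in_sorted_lists [simp]: "[] \<in> sorted_lists D"
  by (simp add: sorted_lists_def)

text \<open>Concatenating two lists only adds the nonnegative increment at the junction.\<close>

lemma list_variation_superadditive:
  assumes "s \<le> t" "t \<le> r"
  shows "list_variation c x {s..t} + list_variation c x {t..r} \<le> list_variation c x {s..r}"
proof -
  have "increment_sum c x us + increment_sum c x vs \<le> list_variation c x {s..r}"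
    if "us \<in> sorted_lists {s..t}" "vs \<in> sorted_lists {t..r}" for us vs
  proof -
    have "us @ vs \<in> sorted_lists {s..r}"
      using that assms by (fastforce simp: sorted_lists_def sorted_append)
    then show ?thesis
      unfolding list_variation_def
      by (meson SUP_upper2 increment_sum_append_ge)
  qed
  then have "(SUP us\<in>sorted_lists {s..t}. SUP vs\<in>sorted_lists {t..r}. increment_sum c x us + increment_sum c x vs)
      \<le> list_variation c x {s..r}"
    by (intro SUP_least)
  moreover have "sorted_lists D \<noteq> {}" for D
    using Nil_in_sorted_lists by blast
  ultimately show ?thesis
    unfolding list_variation_def[of c x "{s..t}"] list_variation_def[of c x "{t..r}"]
    by (subst ennreal_SUP_add_left[symmetric], simp, subst ennreal_SUP_add_right) simp_all
qed

text \<open>A list is cut at \<open>t\<close> and \<open>t\<close> is inserted into both halves, at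
  the cost of one \<open>c\<close> by \<open>increment_sum_append_le\<close>.\<close>

lemma list_variation_subadditive:
  assumes "s \<le> t" "t \<le> r" "0 \<le> c"
  shows "list_variation c x {s..r}
    \<le> list_variation c x {s..t} + list_variation c x {t..r} + ennreal c"
  unfolding list_variation_def[of c x "{s..r}"]
proof (rule SUP_least)
  fix us assume us: "us \<in> sorted_lists {s..r}"
  define vs ws where "vs = filter (\<lambda>u. u < t) us" and "ws = filter (\<lambda>u. t \<le> u) us"
  have "us = vs @ ws"
  proof -
    have "sorted us" using us by (simp add: sorted_lists_def)
    then show ?thesis unfolding vs_def ws_def
    proof (induction us)
      case (Cons u us)
      show ?case
      proof (cases "u < t")
        case False
        then have "filter (\<lambda>u. u < t) us = []" "filter (\<lambda>u. t \<le> u) us = us"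
          using Cons.prems by (auto simp: filter_empty_conv filter_id_conv)
        then show ?thesis using False by simp
      qed (use Cons in auto)
    qed simp
  qed
  moreover have "vs @ [t] \<in> sorted_lists {s..t}" "t # ws \<in> sorted_lists {t..r}"
    using us assms
    by (auto simp: sorted_lists_def vs_def ws_def sorted_append intro!: sorted_filter[of id, simplified])
  ultimately show "increment_sum c x us
      \<le> list_variation c x {s..t} + list_variation c x {t..r} + ennreal c"
    using increment_sum_append_le[OF \<open>0 \<le> c\<close>, of x vs ws t]
    unfolding list_variation_def
    by (simp only:) (erule order_trans, intro add_mono SUP_upper order_refl)
qed

lemma list_variation_mono: "D \<subseteq> E \<Longrightarrow> list_variation c x D \<le> list_variation c x E"
  unfolding list_variation_def sorted_lists_def by (rule SUP_subset_mono) auto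

text \<open>Induction on the number of members: all members other than the one with the largest left
  endpoint u end at or before u, so superadditivity at u separates it from them. The right end
  \<open>t\<close> is generalised because it shrinks to u.\<close>

lemma sum_le_list_variation:
  assumes "finite \<pi>"
    and "\<And>I. I \<in> \<pi> \<Longrightarrow> \<exists>u v. s \<le> u \<and> u < v \<and> v \<le> t \<and> I = {u..v}"
    and "\<And>I J. I \<in> \<pi> \<Longrightarrow> J \<in> \<pi> \<Longrightarrow> I \<noteq> J \<Longrightarrow> interior I \<inter> interior J = {}"
  shows "(\<Sum>I\<in>\<pi>. ennreal (max (\<bar>x (Sup I) - x (Inf I)\<bar> - c) 0)) \<le> list_variation c x {s..t}"
  using assms
proof (induction "card \<pi>" arbitrary: \<pi> t)
  case (Suc n)
  let ?\<phi> = "\<lambda>I. ennreal (max (\<bar>x (Sup I) - x (Inf I)\<bar> - c) 0)"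
  have "\<pi> \<noteq> {}" using Suc.hyps(2) by auto
  then have "Max (Inf ` \<pi>) \<in> Inf ` \<pi>"
    using Suc.prems(1) by (intro Max_in) auto
  then obtain I where I: "I \<in> \<pi>" "Max (Inf ` \<pi>) = Inf I"
    by (rule imageE) simp
  then have I_max: "Inf J \<le> Inf I" if "J \<in> \<pi>" for J
    using Max_ge[of "Inf ` \<pi>" "Inf J"] Suc.prems(1) that by simp
  obtain u v where uv: "s \<le> u" "u < v" "v \<le> t" "I = {u..v}"
    using Suc.prems(2) I(1) by blast
  have "(\<Sum>J\<in>\<pi> - {I}. ?\<phi> J) \<le> list_variation c x {s..u}"
  proof (rule Suc.hyps(1))
    fix J assume J: "J \<in> \<pi> - {I}"
    then obtain u' v' where J': "s \<le> u'" "u' < v'" "v' \<le> t" "J = {u'..v'}"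
      using Suc.prems(2) by blast
    have "interior {u..v} \<inter> interior {u'..v'} = {}" "u' \<le> u"
      using Suc.prems(3)[of I J] I J J' uv I_max[of J] by auto
    then have "v' \<le> u"
      using le_of_disjoint_interiors[of u v u' v'] uv J' by blast
    then show "\<exists>u' v'. s \<le> u' \<and> u' < v' \<and> v' \<le> u \<and> J = {u'..v'}"
      using J' by blast
  qed (use Suc I in auto)
  moreover have "?\<phi> I \<le> list_variation c x {u..t}"
    unfolding list_variation_def
    by (rule SUP_upper2[of "[u, v]"]) (use uv in \<open>auto simp: sorted_lists_def\<close>)
  ultimately have "(\<Sum>J\<in>\<pi> - {I}. ?\<phi> J) + ?\<phi> I \<le> list_variation c x {s..t}"
    using list_variation_superadditive[of s u t c x] uv
    by (meson add_mono order_trans less_imp_le)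
  moreover have "sum ?\<phi> \<pi> = ?\<phi> I + (\<Sum>J\<in>\<pi> - {I}. ?\<phi> J)"
    by (rule sum.remove) (use Suc.prems I in auto)
  ultimately show ?case by (simp add: add.commute)
qed simp

text \<open>The intervals between consecutive distinct points need not cover {s..t}; the gaps are
  filled later. The bound by \<open>{hd us..t}\<close> strengthens the induction: it keeps the
  interior of the next interval, added on the left, disjoint from the earlier ones.\<close>

lemma ex_partial_division_of_sorted_list:
  assumes "sorted us" "set us \<subseteq> {s..t}" "0 \<le> c"
  shows "\<exists>\<pi>. \<pi> division_of \<Union>\<pi> \<and> \<Union>\<pi> \<subseteq> {s..t} \<and> (us \<noteq> [] \<longrightarrow> \<Union>\<pi> \<subseteq> {hd us..t})
    \<and> increment_sum c x us \<le> (\<Sum>I\<in>\<pi>. ennreal (max (\<bar>x (Sup I) - x (Inf I)\<bar> - c) 0))"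
  using assms
proof (induction us rule: induct_list012)
  case (3 u v us)
  let ?\<phi> = "\<lambda>I. ennreal (max (\<bar>x (Sup I) - x (Inf I)\<bar> - c) 0)"
  have "sorted (v # us)" "set (v # us) \<subseteq> {s..t}"
    using 3(3,4) by auto
  from 3(2)[OF this \<open>0 \<le> c\<close>]
  obtain \<pi> where \<pi>: "\<pi> division_of \<Union>\<pi>" "\<Union>\<pi> \<subseteq> {s..t}" "\<Union>\<pi> \<subseteq> {v..t}"
    "increment_sum c x (v # us) \<le> sum ?\<phi> \<pi>"
    by auto
  show ?case
  proof (cases "u = v")
    case True
    then show ?thesis using \<pi> \<open>0 \<le> c\<close> by (intro exI[of _ \<pi>]) (auto simp: max_def)
  next
    case False
    then have "u < v" using 3(3) by simp
    have notin: "{u..v} \<notin> \<pi>"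
      using \<pi>(3) \<open>u < v\<close> by force
    have "interior (\<Union>\<pi>) \<subseteq> interior {v..t}"
      using \<pi>(3) by (rule interior_mono)
    then have "interior {u..v} \<inter> interior (\<Union>\<pi>) = {}"
      by (auto simp: interior_atLeastAtMost_real)
    moreover have "{{u..v}} division_of {u..v}"
      using \<open>u < v\<close> division_of_self[of u v] by (simp add: cbox_interval)
    ultimately have "insert {u..v} \<pi> division_of \<Union>(insert {u..v} \<pi>)"
      using division_disjoint_union[OF _ \<pi>(1), of "{{u..v}}" "{u..v}"] by simp
    moreover have "increment_sum c x (u # v # us) \<le> sum ?\<phi> (insert {u..v} \<pi>)"
      using \<pi>(1,4) notin \<open>u < v\<close> by (subst sum.insert) (auto intro: add_left_mono)
    moreover have "{u..v} \<subseteq> {u..t}" "{v..t} \<subseteq> {u..t}" "{u..t} \<subseteq> {s..t}"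
      using 3(3,4) by auto
    then have "\<Union>(insert {u..v} \<pi>) \<subseteq> {u..t}" "\<Union>(insert {u..v} \<pi>) \<subseteq> {s..t}"
      using \<pi>(3) unfolding Union_insert by blast+
    ultimately show ?thesis
      unfolding list.sel by (intro exI[of _ "insert {u..v} \<pi>"] conjI impI)
  qed
qed (auto intro!: exI[of _ "{}"])

text \<open>One direction discards the one-point members of a division, which contribute 0. The
  other extends a partial division to a full one, which can only add nonnegative summands.\<close>

lemma truncated_variation_eq_list_variation:
  assumes "0 \<le> c"
  shows "truncated_variation c x s t = list_variation c x {s..t}"
proof (rule antisym)
  let ?\<phi> = "\<lambda>I. ennreal (max (\<bar>x (Sup I) - x (Inf I)\<bar> - c) 0)"
  show "truncated_variation c x s t \<le> list_variation c x {s..t}"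
    unfolding truncated_variation_def
  proof (rule SUP_least)
    fix \<pi> assume "\<pi> \<in> {\<pi>. \<pi> division_of {s..t}}"
    then have \<pi>: "\<pi> division_of {s..t}" by simp
    define \<pi>' where "\<pi>' = {I \<in> \<pi>. Inf I < Sup I}"
    have intervals: "\<exists>u v. s \<le> u \<and> u \<le> v \<and> v \<le> t \<and> I = {u..v}" if "I \<in> \<pi>" for I
      using division_ofD(2-4)[OF \<pi> that] by (fastforce simp: cbox_interval)
    have "sum ?\<phi> \<pi> = sum ?\<phi> \<pi>'"
    proof (rule sum.mono_neutral_right)
      show "\<forall>I\<in>\<pi> - \<pi>'. ?\<phi> I = 0"
      proof
        fix I assume I: "I \<in> \<pi> - \<pi>'"
        then obtain u v where "u \<le> v" "I = {u..v}" using intervals by blast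
        then show "?\<phi> I = 0" using I \<open>0 \<le> c\<close> by (auto simp: \<pi>'_def not_less ennreal_neg)
      qed
    qed (use \<pi> in \<open>auto simp: \<pi>'_def\<close>)
    also have "\<dots> \<le> list_variation c x {s..t}"
    proof (rule sum_le_list_variation)
      show "\<exists>u v. s \<le> u \<and> u < v \<and> v \<le> t \<and> I = {u..v}" if "I \<in> \<pi>'" for I
        using intervals[of I] that unfolding \<pi>'_def by fastforce
    qed (use division_ofD(5)[OF \<pi>] \<pi> in \<open>auto simp: \<pi>'_def\<close>)
    finally show "sum ?\<phi> \<pi> \<le> list_variation c x {s..t}" .
  qed
  show "list_variation c x {s..t} \<le> truncated_variation c x s t"
    unfolding list_variation_def
  proof (rule SUP_least)
    fix us assume "us \<in> sorted_lists {s..t}"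
    then obtain \<pi> where \<pi>: "\<pi> division_of \<Union>\<pi>" "\<Union>\<pi> \<subseteq> cbox s t"
      "increment_sum c x us \<le> sum ?\<phi> \<pi>"
      using ex_partial_division_of_sorted_list[of us s t c x] assms
      by (auto simp: sorted_lists_def cbox_interval)
    obtain \<pi>' where \<pi>': "\<pi> \<subseteq> \<pi>'" "\<pi>' division_of cbox s t"
      using partial_division_extend_interval[OF \<pi>(1,2)] .
    have "sum ?\<phi> \<pi> \<le> sum ?\<phi> \<pi>'"
      using \<pi>' by (intro sum_mono2) auto
    then show "increment_sum c x us \<le> truncated_variation c x s t"
      unfolding truncated_variation_def
      using \<pi>'(2) \<pi>(3) by (intro SUP_upper2[of \<pi>']) (auto simp: cbox_interval)
  qed
qed

section \<open>Reduction to countably many partition points, and measurability\<close>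

lemma increment_sum_tendsto:
  assumes "\<And>u. u \<in> set us \<Longrightarrow> (\<lambda>k. x (f k u)) \<longlonglongrightarrow> x u"
  shows "(\<lambda>k::nat. increment_sum c (\<lambda>u. x (f k u)) us) \<longlonglongrightarrow> increment_sum c x us"
  using assms
proof (induction us rule: induct_list012)
  case (3 u v us)
  have "(\<lambda>k. ennreal (max (\<bar>x (f k v) - x (f k u)\<bar> - c) 0) + increment_sum c (\<lambda>u. x (f k u)) (v # us))
      \<longlonglongrightarrow> ennreal (max (\<bar>x v - x u\<bar> - c) 0) + increment_sum c x (v # us)"
    by (intro tendsto_add tendsto_ennrealI tendsto_max tendsto_diff tendsto_rabs tendsto_const)
      (use 3 in auto)
  then show ?case by simp
qed auto

text \<open>Rounding partition points up to \<open>\<rat> \<union> {t}\<close> is monotone, and by right continuity it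
  changes the increments arbitrarily little, so countably many partitions suffice.\<close>

lemma list_variation_countable:
  assumes right: "\<And>u. s \<le> u \<Longrightarrow> u < t \<Longrightarrow> (x \<longlongrightarrow> x u) (at_right u)"
  shows "list_variation c x {s..t} = list_variation c x ({s..t} \<inter> insert t \<rat>)"
proof (rule antisym)
  show "list_variation c x {s..t} \<le> list_variation c x ({s..t} \<inter> insert t \<rat>)"
    unfolding list_variation_def[of c x "{s..t}"]
  proof (rule SUP_least)
    fix us assume us: "us \<in> sorted_lists {s..t}"
    \<comment> \<open>Floor plus 1, rather than the ceiling, makes \<open>f k u\<close> strictly
      larger than u for u < t, as convergence along \<open>at_right u\<close> requires. The minimum
      keeps the points in {s..t} and fixes \<open>t\<close>, where no continuity is assumed.\<close>
    define f where "f k u = min t ((of_int \<lfloor>real (Suc k) * u\<rfloor> + 1) / real (Suc k))" for k u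
    have f_lim: "(\<lambda>k. x (f k u)) \<longlonglongrightarrow> x u" if "u \<in> set us" for u
    proof (cases "u = t")
      case True
      have "f k t = t" for k
      proof -
        have "real (Suc k) * t \<le> of_int \<lfloor>real (Suc k) * t\<rfloor> + 1" by linarith
        then have "t \<le> (of_int \<lfloor>real (Suc k) * t\<rfloor> + 1) / real (Suc k)"
          by (simp add: pos_le_divide_eq mult.commute)
        then show ?thesis by (simp add: f_def)
      qed
      then show ?thesis using True by simp
    next
      case False
      then have u: "s \<le> u" "u < t" using us that by (auto simp: sorted_lists_def less_le)
      have bounds: "u < f k u \<and> f k u \<le> u + 1 / real (Suc k)" for k
      proof -
        have "real (Suc k) * u < of_int \<lfloor>real (Suc k) * u\<rfloor> + 1"
          "of_int \<lfloor>real (Suc k) * u\<rfloor> + 1 \<le> real (Suc k) * u + 1"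
          by linarith+
        then have "u < (of_int \<lfloor>real (Suc k) * u\<rfloor> + 1) / real (Suc k)"
          "(of_int \<lfloor>real (Suc k) * u\<rfloor> + 1) / real (Suc k) \<le> (real (Suc k) * u + 1) / real (Suc k)"
          by (simp_all add: pos_less_divide_eq pos_divide_le_eq mult.commute divide_right_mono
              del: of_nat_Suc)
        moreover have "(real (Suc k) * u + 1) / real (Suc k) = u + 1 / real (Suc k)"
          by (simp add: add_divide_distrib)
        ultimately show ?thesis using u by (auto simp: f_def simp del: of_nat_Suc)
      qed
      have "(\<lambda>k. u + 1 / real (Suc k)) \<longlonglongrightarrow> u + 0"
        by (intro tendsto_add tendsto_const LIMSEQ_Suc lim_1_over_n)
      then have "(\<lambda>k. f k u) \<longlonglongrightarrow> u"
        using bounds by (intro tendsto_sandwich[of "\<lambda>_. u" "\<lambda>k. f k u" _ "\<lambda>k. u + 1 / real (Suc k)" u])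
          (auto intro!: always_eventually less_imp_le simp del: of_nat_Suc)
      then have "filterlim (\<lambda>k. f k u) (at_right u) sequentially"
        using bounds by (auto simp: filterlim_at less_imp_neq[symmetric] intro!: always_eventually)
      then show ?thesis
        using filterlim_compose[OF right[OF u]] by blast
    qed
    have "map (f k) us \<in> sorted_lists ({s..t} \<inter> insert t \<rat>)" for k
    proof -
      have "mono (f k)"
        unfolding f_def mono_def
        by (intro allI impI min.mono order_refl divide_right_mono add_right_mono)
          (auto intro!: floor_mono mult_left_mono simp del: of_nat_Suc)
      then have "sorted (map (f k) us)"
        using us by (auto simp: sorted_lists_def sorted_map monoD intro: sorted_wrt_mono_rel[of us "(\<le>)"])
      moreover have "f k u \<in> {s..t} \<inter> insert t \<rat>" if "u \<in> set us" for u
      proof -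
        have "real (Suc k) * u \<le> of_int \<lfloor>real (Suc k) * u\<rfloor> + 1" by linarith
        then have "u \<le> (of_int \<lfloor>real (Suc k) * u\<rfloor> + 1) / real (Suc k)"
          by (simp add: pos_le_divide_eq mult.commute)
        moreover have "s \<le> u" "u \<le> t" using us that by (auto simp: sorted_lists_def)
        moreover have "(of_int \<lfloor>real (Suc k) * u\<rfloor> + 1) / real (Suc k) \<in> \<rat>"
          by (intro Rats_divide Rats_add Rats_of_int Rats_1 Rats_of_nat)
        ultimately show ?thesis unfolding f_def min_def by auto
      qed
      ultimately show ?thesis by (auto simp: sorted_lists_def)
    qed
    then have "increment_sum c (\<lambda>u. x (f k u)) us \<le> list_variation c x ({s..t} \<inter> insert t \<rat>)" for k
      unfolding list_variation_def increment_sum_map[symmetric] by (rule SUP_upper)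
    then show "increment_sum c x us \<le> list_variation c x ({s..t} \<inter> insert t \<rat>)"
      by (intro LIMSEQ_le_const2[OF increment_sum_tendsto[where f = f]]) (use f_lim in auto)
  qed
qed (rule list_variation_mono, simp)

text \<open>A countable \<open>D\<close> has countably many finite lists, and each sum depends on
  finitely many coordinates.\<close>

lemma measurable_list_variation [measurable]:
  assumes "countable D" "D \<subseteq> {0..}"
  shows "(\<lambda>x. list_variation c x D) \<in> borel_measurable (\<Pi>\<^sub>M t\<in>{0..}. borel)"
  unfolding list_variation_def
proof (rule borel_measurable_SUP)
  show "countable (sorted_lists D)"
    using assms(1) by (rule countable_subset[OF _ countable_lists, rotated]) (auto simp: sorted_lists_def)
  fix us assume "us \<in> sorted_lists D"
  then have "set us \<subseteq> {0..}" using assms(2) by (auto simp: sorted_lists_def)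
  then show "(\<lambda>x. increment_sum c x us) \<in> borel_measurable (\<Pi>\<^sub>M t\<in>{0..}. borel)"
  proof (induction us rule: induct_list012)
    case (3 u v us)
    have [measurable]: "(\<lambda>x. x u :: real) \<in> borel_measurable (\<Pi>\<^sub>M t\<in>{0..}. borel)"
      "(\<lambda>x. x v :: real) \<in> borel_measurable (\<Pi>\<^sub>M t\<in>{0..}. borel)"
      using 3(3) by (auto intro!: measurable_component_singleton)
    have [measurable]: "(\<lambda>x. increment_sum c x (v # us)) \<in> borel_measurable (\<Pi>\<^sub>M t\<in>{0..}. borel)"
      using 3 by simp
    show ?case by (simp del: increment_sum.simps add: increment_sum.simps(1)) measurable
  qed simp_all
qed

section \<open>Behaviour under translation and scaling of values and of time\<close>

lemma list_variation_cong:
  "(\<And>u. u \<in> D \<Longrightarrow> x u = y u) \<Longrightarrow> list_variation c x D = list_variation c y D"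
  unfolding list_variation_def
  by (intro SUP_cong refl increment_sum_cong) (auto simp: sorted_lists_def)

lemma list_variation_diff_const: "list_variation c (\<lambda>u. x u - a) D = list_variation c x D"
  by (simp add: list_variation_def increment_sum_diff_const)

lemma list_variation_scale:
  "0 < a \<Longrightarrow> list_variation c (\<lambda>u. a * x u) D = ennreal a * list_variation (c / a) x D"
  by (simp add: list_variation_def increment_sum_scale SUP_mult_left_ennreal)

lemma list_variation_affine:
  assumes "0 < a"
  shows "list_variation c (\<lambda>u. x (a * u + b)) {s..t} = list_variation c x {a * s + b..a * t + b}"
proof -
  have le: "list_variation c (\<lambda>u. x (a * u + b)) {s..t} \<le> list_variation c x {a * s + b..a * t + b}"
    if "0 < a" for a b s t and x :: "real \<Rightarrow> real"
    unfolding list_variation_def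
  proof (rule SUP_least)
    fix us assume "us \<in> sorted_lists {s..t}"
    then have "map (\<lambda>u. a * u + b) us \<in> sorted_lists {a * s + b..a * t + b}"
      using that by (auto simp: sorted_lists_def sorted_map intro: sorted_wrt_mono_rel[of us "(\<le>)"])
    then show "increment_sum c (\<lambda>u. x (a * u + b)) us
        \<le> (SUP us\<in>sorted_lists {a * s + b..a * t + b}. increment_sum c x us)"
      unfolding increment_sum_map[symmetric, of c x "\<lambda>u. a * u + b"] by (rule SUP_upper)
  qed
  \<comment> \<open>The reverse inequality is \<open>le\<close> applied to the inverse time
    change.\<close>
  have "1 / a * (a * s + b) + - b / a = s" "1 / a * (a * t + b) + - b / a = t"
    "a * (1 / a * u + - b / a) + b = u" for u
    using assms by (simp_all add: field_simps)
  then have "list_variation c x {a * s + b..a * t + b} \<le> list_variation c (\<lambda>u. x (a * u + b)) {s..t}"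
    using le[of "1 / a" "\<lambda>u. x (a * u + b)" "- b / a" "a * s + b" "a * t + b"] assms by simp
  then show ?thesis
    using le[OF assms] by (intro antisym)
qed

lemma truncated_variation_affine:
  "0 \<le> c \<Longrightarrow> 0 < a \<Longrightarrow>
    truncated_variation c (\<lambda>u. x (a * u + b)) s t = truncated_variation c x (a * s + b) (a * t + b)"
  by (simp add: truncated_variation_eq_list_variation list_variation_affine)

lemma truncated_variation_diff_const:
  "0 \<le> c \<Longrightarrow> truncated_variation c (\<lambda>u. x u - a) s t = truncated_variation c x s t"
  by (simp add: truncated_variation_eq_list_variation list_variation_diff_const)

lemma truncated_variation_scale:
  "0 \<le> c \<Longrightarrow> 0 < a \<Longrightarrow>
    truncated_variation c (\<lambda>u. a * x u) s t = ennreal a * truncated_variation (c / a) x s t"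
  by (simp add: truncated_variation_eq_list_variation list_variation_scale)

lemma truncated_variation_mono:
  "0 \<le> c \<Longrightarrow> s' \<le> s \<Longrightarrow> t \<le> t' \<Longrightarrow> truncated_variation c x s t \<le> truncated_variation c x s' t'"
  by (simp add: truncated_variation_eq_list_variation list_variation_mono)

lemma truncated_variation_ge_increment:
  assumes "0 \<le> c" "s \<le> u" "u \<le> v" "v \<le> t"
  shows "ennreal (\<bar>x v - x u\<bar> - c) \<le> truncated_variation c x s t"
  unfolding truncated_variation_eq_list_variation[OF assms(1)] list_variation_def
  by (rule SUP_upper2[of "[u, v]"]) (use assms in \<open>auto simp: sorted_lists_def intro!: ennreal_leI\<close>)

lemma truncated_variation_self:
  assumes "0 \<le> c"
  shows "truncated_variation c x t t = 0"
proof -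
  have "increment_sum c x us = 0" if "set us \<subseteq> {t}" for us
    using that assms by (induction us rule: induct_list012) (auto simp: ennreal_neg)
  then show ?thesis
    unfolding truncated_variation_eq_list_variation[OF assms] list_variation_def sorted_lists_def
    by (intro antisym SUP_least) auto
qed

lemma sum_truncated_variation_le:
  assumes "0 \<le> a"
  shows "(\<Sum>i<n. truncated_variation 1 x (real i * a) (real (Suc i) * a))
    \<le> truncated_variation 1 x 0 (real n * a)"
proof (induction n)
  case (Suc n)
  have "truncated_variation 1 x 0 (real n * a) + truncated_variation 1 x (real n * a) (real (Suc n) * a)
      \<le> truncated_variation 1 x 0 (real (Suc n) * a)"
    using assms by (simp add: truncated_variation_eq_list_variation list_variation_superadditive mult_right_mono)
  then show ?case
    using Suc by (auto intro: order_trans[OF add_right_mono])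
qed simp

text \<open>Each induction step cuts off one block and costs the threshold 1. The first step also
  cuts, at time 0, hence n and not n - 1.\<close>

lemma truncated_variation_le_sum:
  assumes "0 \<le> a"
  shows "truncated_variation 1 x 0 (real n * a)
    \<le> (\<Sum>i<n. truncated_variation 1 x (real i * a) (real (Suc i) * a)) + of_nat n"
proof (induction n)
  case (Suc n)
  have "truncated_variation 1 x 0 (real (Suc n) * a)
      \<le> truncated_variation 1 x 0 (real n * a) + truncated_variation 1 x (real n * a) (real (Suc n) * a) + ennreal 1"
    unfolding truncated_variation_eq_list_variation[OF zero_le_one]
    by (rule list_variation_subadditive) (use assms in \<open>simp_all add: mult_right_mono\<close>)
  also have "\<dots> \<le> ((\<Sum>i<n. truncated_variation 1 x (real i * a) (real (Suc i) * a)) + of_nat n)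
      + truncated_variation 1 x (real n * a) (real (Suc n) * a) + 1"
    by (intro add_mono Suc) simp_all
  finally show ?case by (simp add: add_ac)
qed (simp add: truncated_variation_self)

section \<open>Transfer of laws\<close>

lemma distr_comp_eq:
  assumes "f \<in> measurable M N" "g \<in> measurable M N" "distr M N f = distr M N g" "\<Phi> \<in> measurable N L"
  shows "distr M L (\<lambda>\<omega>. \<Phi> (f \<omega>)) = distr M L (\<lambda>\<omega>. \<Phi> (g \<omega>))"
  using distr_distr[OF assms(4,1)] distr_distr[OF assms(4,2)] assms(3) by (simp add: comp_def)

abbreviation path_space :: "(real \<Rightarrow> real) measure" where
  "path_space \<equiv> \<Pi>\<^sub>M t\<in>{0..}. borel"

definition right_continuous :: "(real \<Rightarrow> real) \<Rightarrow> bool" where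
  "right_continuous x \<longleftrightarrow> (\<forall>t\<ge>0. (x \<longlongrightarrow> x t) (at_right t))"

lemma right_continuous_affine:
  assumes "right_continuous x" "0 < a" "0 \<le> b"
  shows "right_continuous (\<lambda>t. x (a * t + b))"
  unfolding right_continuous_def
proof (intro allI impI)
  fix t :: real assume "0 \<le> t"
  then have "(x \<longlongrightarrow> x (a * t + b)) (at_right (a * t + b))"
    using assms by (simp add: right_continuous_def)
  moreover have "filterlim (\<lambda>t. a * t + b) (at_right (a * t + b)) (at_right t)"
    using \<open>0 < a\<close> by (auto simp: filterlim_at eventually_at_filter intro!: tendsto_intros)
  ultimately show "((\<lambda>t. x (a * t + b)) \<longlongrightarrow> x (a * t + b)) (at_right t)"
    by (rule filterlim_compose)
qed

lemma right_continuous_diff_const: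
  "right_continuous x \<Longrightarrow> right_continuous (\<lambda>t. x t - a)"
  by (auto simp: right_continuous_def intro!: tendsto_intros)

lemma right_continuous_mult_const:
  "right_continuous x \<Longrightarrow> right_continuous (\<lambda>t. a * x t)"
  by (auto simp: right_continuous_def intro!: tendsto_intros)

text \<open>The right-hand side is a measurable functional of the path in \<open>path_space\<close>;
  this identity carries equalities of path laws over to truncated variations.\<close>

lemma truncated_variation_eq_on_path_space:
  assumes "0 \<le> c" "0 \<le> s" "right_continuous x"
  shows "truncated_variation c x s t = list_variation c (\<lambda>u\<in>{0..}. x u) ({s..t} \<inter> insert t \<rat>)"
proof -
  have "truncated_variation c x s t = list_variation c x ({s..t} \<inter> insert t \<rat>)"
    unfolding truncated_variation_eq_list_variation[OF assms(1)]
    by (rule list_variation_countable) (use assms in \<open>auto simp: right_continuous_def\<close>)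
  also have "\<dots> = list_variation c (\<lambda>u\<in>{0..}. x u) ({s..t} \<inter> insert t \<rat>)"
    by (rule list_variation_cong) (use assms in auto)
  finally show ?thesis .
qed

lemma measurable_list_variation_rat [measurable]:
  "0 \<le> s \<Longrightarrow> (\<lambda>x. list_variation c x ({s..t} \<inter> insert t \<rat>)) \<in> borel_measurable path_space"
  by (rule measurable_list_variation) (auto intro: countable_rat)

lemma measurable_path [measurable]:
  "(\<And>t. 0 \<le> t \<Longrightarrow> X t \<in> borel_measurable M) \<Longrightarrow> (\<lambda>\<omega>. \<lambda>t\<in>{0..}. X t \<omega>) \<in> measurable M path_space"
  by (rule measurable_restrict) auto

lemma borel_measurable_truncated_variation:
  assumes "\<And>t. 0 \<le> t \<Longrightarrow> X t \<in> borel_measurable M" "0 \<le> c" "0 \<le> s"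
    and "\<And>\<omega>. \<omega> \<in> space M \<Longrightarrow> right_continuous (\<lambda>t. X t \<omega>)"
  shows "(\<lambda>\<omega>. truncated_variation c (\<lambda>t. X t \<omega>) s t) \<in> borel_measurable M"
  using measurable_compose[OF measurable_path[OF assms(1)] measurable_list_variation_rat[OF assms(3)]]
  by (subst measurable_cong[OF truncated_variation_eq_on_path_space]) (use assms in auto)

text \<open>The joint law over infinitely many intervals is what stationarity of the block sequences
  calls for.\<close>

lemma distr_truncated_variation_eq:
  fixes s t :: "nat \<Rightarrow> real"
  assumes X: "\<And>t. 0 \<le> t \<Longrightarrow> X t \<in> borel_measurable M"
    "\<And>\<omega>. \<omega> \<in> space M \<Longrightarrow> right_continuous (\<lambda>t. X t \<omega>)"
    and Y: "\<And>t. 0 \<le> t \<Longrightarrow> Y t \<in> borel_measurable M"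
    "\<And>\<omega>. \<omega> \<in> space M \<Longrightarrow> right_continuous (\<lambda>t. Y t \<omega>)"
    and law: "distr M path_space (\<lambda>\<omega>. \<lambda>t\<in>{0..}. X t \<omega>) = distr M path_space (\<lambda>\<omega>. \<lambda>t\<in>{0..}. Y t \<omega>)"
    and c: "0 \<le> c" and s: "\<And>n. 0 \<le> s n"
  shows "distr M (\<Pi>\<^sub>M n\<in>UNIV. borel) (\<lambda>\<omega> n. truncated_variation c (\<lambda>t. X t \<omega>) (s n) (t n))
    = distr M (\<Pi>\<^sub>M n\<in>UNIV. borel) (\<lambda>\<omega> n. truncated_variation c (\<lambda>t. Y t \<omega>) (s n) (t n))"
proof -
  let ?\<Phi> = "\<lambda>x n. list_variation c x ({s n..t n} \<inter> insert (t n) \<rat>)"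
  have "?\<Phi> \<in> measurable path_space (\<Pi>\<^sub>M n\<in>UNIV. borel)"
    by (rule measurable_PiM_single') (use s in auto)
  from distr_comp_eq[OF measurable_path[OF X(1)] measurable_path[OF Y(1)] law this]
  show ?thesis
    using X(2) Y(2) by (subst (1 2) distr_cong[OF refl refl ext[OF truncated_variation_eq_on_path_space[OF c s]]]) auto
qed

lemma distr_truncated_variation_eq1:
  assumes X: "\<And>t. 0 \<le> t \<Longrightarrow> X t \<in> borel_measurable M"
    "\<And>\<omega>. \<omega> \<in> space M \<Longrightarrow> right_continuous (\<lambda>t. X t \<omega>)"
    and Y: "\<And>t. 0 \<le> t \<Longrightarrow> Y t \<in> borel_measurable M"
    "\<And>\<omega>. \<omega> \<in> space M \<Longrightarrow> right_continuous (\<lambda>t. Y t \<omega>)"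
    and law: "distr M path_space (\<lambda>\<omega>. \<lambda>t\<in>{0..}. X t \<omega>) = distr M path_space (\<lambda>\<omega>. \<lambda>t\<in>{0..}. Y t \<omega>)"
    and c: "0 \<le> c" and s: "0 \<le> s"
  shows "distr M borel (\<lambda>\<omega>. truncated_variation c (\<lambda>t. X t \<omega>) s t)
    = distr M borel (\<lambda>\<omega>. truncated_variation c (\<lambda>t. Y t \<omega>) s t)"
  using distr_comp_eq[OF measurable_path[OF X(1)] measurable_path[OF Y(1)] law
      measurable_list_variation_rat[OF s, of c t]] X(2) Y(2)
  by (subst (1 2) distr_cong[OF refl refl truncated_variation_eq_on_path_space[OF c s]]) auto

text \<open>The definition of stationary increments concerns finitely many consecutive increments.
  Summing them gives the finite-dimensional laws of the increments from a fixed origin, and these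
  determine a finite measure on the infinite product.\<close>

lemma distr_increments_eq:
  assumes "prob_space M"
    and X [measurable]: "\<And>t. 0 \<le> t \<Longrightarrow> X t \<in> borel_measurable M"
    and stat: "stationary_increments M X" and "0 < h"
  shows "distr M path_space (\<lambda>\<omega>. \<lambda>t\<in>{0..}. X t \<omega> - X 0 \<omega>)
    = distr M path_space (\<lambda>\<omega>. \<lambda>t\<in>{0..}. X (t + h) \<omega> - X h \<omega>)"
proof (rule measure_eqI_PiM_infinite)
  interpret prob_space M by fact
  have meas: "(\<lambda>\<omega>. \<lambda>t\<in>{0..}. X (t + r) \<omega> - X r \<omega>) \<in> measurable M path_space" if "0 \<le> r" for r
    using that by (intro measurable_path) auto
  show "finite_measure (distr M path_space (\<lambda>\<omega>. \<lambda>t\<in>{0..}. X t \<omega> - X 0 \<omega>))"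
    using prob_space_distr[OF meas[of 0]] by (simp add: prob_space_def)
  fix A J assume J: "finite J" "J \<subseteq> {0::real..}" and A: "\<And>i. i \<in> J \<Longrightarrow> A i \<in> sets (borel :: real measure)"
  \<comment> \<open>Including 0 makes the grid start at the origin of the increments. In
    \<open>t\<close> the positions are shifted by one, as \<open>stationary_increments\<close>
    numbers the times from 1.\<close>
  define l where "l = sorted_list_of_set (insert 0 J)"
  define n where "n = length l"
  define t where "t i = l ! (i - 1)" for i
  have l: "sorted_wrt (<) l" "set l = insert 0 J"
    unfolding l_def using J(1) by (simp_all del: sorted_list_of_set_insert_remove)
  have l0: "0 < n" "l ! 0 = 0"
  proof -
    show "0 < n" using l(2) unfolding n_def by (cases l) auto
    have "0 \<in> set l" using l(2) by simp
    then obtain i where i: "i < n" "l ! i = 0"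
      unfolding in_set_conv_nth n_def by blast
    have "l ! 0 \<ge> 0" using l(2) J \<open>0 < n\<close> nth_mem[of 0 l] unfolding n_def by auto
    then show "l ! 0 = 0"
      using i sorted_wrt_nth_less[OF l(1), of 0 i] unfolding n_def by (cases "i = 0") auto
  qed
  have t1: "t 1 = 0" using l0 by (simp add: t_def)
  have t_mono: "strict_mono_on {1..n} t"
    by (rule strict_mono_onI) (auto simp: t_def n_def intro!: sorted_wrt_nth_less[OF l(1)])
  have t_nonneg: "0 \<le> t i" if "i \<in> {1..n}" for i
  proof -
    have "i - 1 < length l" using that by (auto simp: n_def)
    then have "t i \<in> insert 0 J" unfolding t_def l(2)[symmetric] by (rule nth_mem)
    then show ?thesis using J(2) by auto
  qed
  have "\<exists>m\<in>{1..n}. t m = j" if "j \<in> J" for j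
  proof -
    have "j \<in> set l" using that l(2) by simp
    then obtain i where "i < n" "l ! i = j"
      unfolding in_set_conv_nth n_def by blast
    then show ?thesis by (intro bexI[of _ "Suc i"]) (auto simp: t_def)
  qed
  then have "\<forall>j\<in>J. \<exists>m. m \<in> {1..n} \<and> t m = j" by blast
  then obtain m where "\<forall>j\<in>J. m j \<in> {1..n} \<and> t (m j) = j"
    by (rule bchoice[THEN exE])
  then have m: "\<And>j. j \<in> J \<Longrightarrow> m j \<in> {1..n} \<and> t (m j) = j" by blast
  let ?L = "\<Pi>\<^sub>M i\<in>{1..<n}. (borel :: real measure)"
  let ?inc = "\<lambda>r \<omega>. \<lambda>i\<in>{1..<n}. X (t (i + 1) + r) \<omega> - X (t i + r) \<omega>"
  \<comment> \<open>These partial sums telescope to X (j + r) - X r, with \<open>m j\<close> the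
    index of the grid point j.\<close>
  let ?\<Phi> = "\<lambda>y. \<lambda>j\<in>J. \<Sum>i\<in>{1..<m j}. y i :: real"
  have inc_meas: "?inc r \<in> measurable M ?L" if "0 \<le> r" for r
    using that t_nonneg by (intro measurable_restrict borel_measurable_diff X) auto
  have \<Phi>_meas: "?\<Phi> \<in> measurable ?L (\<Pi>\<^sub>M j\<in>J. borel)"
  proof (intro measurable_restrict borel_measurable_sum measurable_component_singleton)
    fix j i assume "j \<in> J" "i \<in> {1..<m j}"
    then show "i \<in> {1..<n}" using m[of j] by auto
  qed
  have \<Phi>_inc: "?\<Phi> (?inc r \<omega>) = (\<lambda>j\<in>J. X (j + r) \<omega> - X r \<omega>)" for r \<omega>
  proof (rule restrict_ext)
    fix j assume j: "j \<in> J"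
    have "(\<Sum>i\<in>{1..<m j}. ?inc r \<omega> i) = (\<Sum>i\<in>{1..<m j}. X (t (Suc i) + r) \<omega> - X (t i + r) \<omega>)"
      using m[OF j] by (intro sum.cong) auto
    also have "\<dots> = X (t (m j) + r) \<omega> - X (t 1 + r) \<omega>"
      using m[OF j] by (intro sum_Suc_diff') auto
    finally show "(\<Sum>i\<in>{1..<m j}. ?inc r \<omega> i) = X (j + r) \<omega> - X r \<omega>"
      using m[OF j] t1 by simp
  qed
  have "distr M ?L (?inc 0) = distr M ?L (?inc h)"
    using stat[unfolded stationary_increments_def, rule_format, of t n h] t1 t_mono \<open>0 < h\<close> by simp
  from distr_comp_eq[OF inc_meas inc_meas this \<Phi>_meas]
  have eq: "distr M (\<Pi>\<^sub>M j\<in>J. borel) (\<lambda>\<omega>. \<lambda>j\<in>J. X (j + 0) \<omega> - X 0 \<omega>)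
      = distr M (\<Pi>\<^sub>M j\<in>J. borel) (\<lambda>\<omega>. \<lambda>j\<in>J. X (j + h) \<omega> - X h \<omega>)"
    using \<open>0 < h\<close> unfolding \<Phi>_inc by simp
  have emb: "emeasure (distr M path_space (\<lambda>\<omega>. \<lambda>t\<in>{0..}. X (t + r) \<omega> - X r \<omega>))
        (prod_emb {0..} (\<lambda>_. borel) J (Pi\<^sub>E J A))
      = emeasure (distr M (\<Pi>\<^sub>M j\<in>J. borel) (\<lambda>\<omega>. \<lambda>j\<in>J. X (j + r) \<omega> - X r \<omega>)) (Pi\<^sub>E J A)"
    if r: "0 \<le> r" for r
  proof -
    have "(\<lambda>\<omega>. \<lambda>j\<in>J. X (j + r) \<omega> - X r \<omega>) \<in> measurable M (\<Pi>\<^sub>M j\<in>J. borel)"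
      using r J(2) by (intro measurable_restrict borel_measurable_diff X) auto
    moreover have "Pi\<^sub>E J A \<in> sets (\<Pi>\<^sub>M j\<in>J. borel)"
      using J A by (intro sets_PiM_I_finite) auto
    moreover have "prod_emb {0..} (\<lambda>_. borel) J (Pi\<^sub>E J A) \<in> sets path_space"
      using J A by (intro sets_PiM_I) auto
    ultimately show ?thesis
      using subsetD[OF J(2)] by (auto simp: emeasure_distr[OF meas[OF r]] emeasure_distr prod_emb_def PiE_iff
          split: if_splits intro!: arg_cong[where f = "emeasure M"])
  qed
  show "emeasure (distr M path_space (\<lambda>\<omega>. \<lambda>t\<in>{0..}. X t \<omega> - X 0 \<omega>)) (prod_emb {0..} (\<lambda>_. borel) J (Pi\<^sub>E J A))
      = emeasure (distr M path_space (\<lambda>\<omega>. \<lambda>t\<in>{0..}. X (t + h) \<omega> - X h \<omega>)) (prod_emb {0..} (\<lambda>_. borel) J (Pi\<^sub>E J A))"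
    using emb[of 0] emb[of h] eq \<open>0 < h\<close> by simp
qed simp_all

section \<open>Limits of averages\<close>

text \<open>Estimating m (j * k) in two ways gives k * m j \<le> j * m k + j, so every quotient m j
  / j lies below every quotient (m k + 1) / k. The supremum of the former separates the two
  families.\<close>

lemma ex_almost_additive_rate:
  fixes m :: "nat \<Rightarrow> real"
  assumes "\<And>n k. 1 \<le> k \<Longrightarrow> real n * m k \<le> m (n * k)"
    and "\<And>n k. 1 \<le> k \<Longrightarrow> m (n * k) \<le> real n * m k + real n"
  shows "\<exists>C. \<forall>k\<ge>1. m k \<le> real k * C \<and> real k * C \<le> m k + 1"
proof -
  have cross: "m j / real j \<le> (m k + 1) / real k" if "1 \<le> j" "1 \<le> k" for j k
  proof -
    have "real k * m j \<le> real j * m k + real j"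
      using assms(1)[of j k] assms(2)[of k j] that by (simp add: mult.commute)
    then show ?thesis using that by (simp add: field_simps)
  qed
  define C where "C = (SUP j\<in>{1..}. m j / real j)"
  have bdd: "bdd_above ((\<lambda>j. m j / real j) ` {1..})"
    using cross[of _ 1] by (auto intro!: bdd_aboveI2)
  have "m k / real k \<le> C" "C \<le> (m k + 1) / real k" if "1 \<le> k" for k
    unfolding C_def using that cross bdd by (auto intro!: cSUP_upper cSUP_least)
  then show ?thesis by (intro exI[of _ C]) (auto simp: field_simps)
qed

lemma (in prob_space) AE_tendsto_imp_prob_tendsto_0:
  fixes Z :: "real \<Rightarrow> 'a \<Rightarrow> real"
  assumes Z [measurable]: "\<And>r. Z r \<in> borel_measurable M"
    and lim: "AE \<omega> in M. ((\<lambda>r. Z r \<omega>) \<longlongrightarrow> l) at_top" and "0 < \<epsilon>"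
  shows "((\<lambda>r. prob {\<omega> \<in> space M. \<bar>Z r \<omega> - l\<bar> > \<epsilon>}) \<longlongrightarrow> 0) at_top"
\<comment> \<open>Dominated convergence is applied along arbitrary sequences tending to
  infinity.\<close>
proof (rule tendsto_at_topI_sequentially)
  fix r :: "nat \<Rightarrow> real" assume r: "filterlim r at_top sequentially"
  let ?B = "\<lambda>n. {\<omega> \<in> space M. \<bar>Z (r n) \<omega> - l\<bar> > \<epsilon>}"
  have "(\<lambda>n. \<integral>\<omega>. indicator (?B n) \<omega> \<partial>M) \<longlonglongrightarrow> (\<integral>\<omega>. (0::real) \<partial>M)"
  proof (rule integral_dominated_convergence[where w = "\<lambda>_. 1"])
    show "AE \<omega> in M. (\<lambda>n. indicator (?B n) \<omega> :: real) \<longlonglongrightarrow> 0"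
      using lim
    proof eventually_elim
      case (elim \<omega>)
      then have "(\<lambda>n. Z (r n) \<omega>) \<longlonglongrightarrow> l"
        using r by (rule filterlim_compose)
      then have "\<forall>\<^sub>F n in sequentially. \<bar>Z (r n) \<omega> - l\<bar> < \<epsilon>"
        using \<open>0 < \<epsilon>\<close> by (auto simp: tendsto_iff dist_real_def)
      then have "\<forall>\<^sub>F n in sequentially. indicator (?B n) \<omega> = (0::real)"
        by eventually_elim auto
      then show ?case by (rule tendsto_eventually)
    qed
  qed (auto simp: indicator_def)
  then show "(\<lambda>n. prob (?B n)) \<longlonglongrightarrow> 0" by simp
qed

text \<open>For q * k \<le> r \<le> (q + 1) * k monotonicity encloses W r between S k q and S k (q +
  1) + q + 1. Hence all limit points of W r / r lie between m k / k and (m k + 1) / k, an interval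
  of length 1 / k that contains C; given e, a block length with 1 / k < e suffices.\<close>

lemma tendsto_average_at_top:
  fixes W :: "real \<Rightarrow> real" and S :: "nat \<Rightarrow> nat \<Rightarrow> real"
  assumes mono: "\<And>s t. 0 \<le> s \<Longrightarrow> s \<le> t \<Longrightarrow> W s \<le> W t"
    and lower: "\<And>k n. 1 \<le> k \<Longrightarrow> S k n \<le> W (real n * real k)"
    and upper: "\<And>k n. 1 \<le> k \<Longrightarrow> W (real n * real k) \<le> S k n + real n"
    and lim: "\<And>k. 1 \<le> k \<Longrightarrow> (\<lambda>n. S k n / real n) \<longlonglongrightarrow> m k"
    and m: "\<And>k. 1 \<le> k \<Longrightarrow> m k \<le> real k * C" "\<And>k. 1 \<le> k \<Longrightarrow> real k * C \<le> m k + 1"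
  shows "((\<lambda>r. W r / r) \<longlongrightarrow> C) at_top"
proof -
  have ev: "(\<forall>\<^sub>F r in at_top. C - e < W r / r) \<and> (\<forall>\<^sub>F r in at_top. W r / r < C + e)" if "0 < e" for e
  proof -
    obtain j where j: "inverse (real (Suc j)) < e"
      using reals_Archimedean[OF \<open>0 < e\<close>] by blast
    define k where "k = Suc j"
    have k: "1 \<le> k" "1 / real k < e" using j by (simp_all add: k_def divide_inverse)
    define q where "q r = nat \<lfloor>r / k\<rfloor>" for r
    have q_bounds: "r / k - 1 < real (q r)" "real (q r) \<le> r / k" if "0 < r" for r
      using that k unfolding q_def by (simp_all add: of_nat_nat; linarith)+
    have q_lim: "filterlim q at_top at_top"
      unfolding filterlim_at_top
    proof
      fix N :: nat
      show "\<forall>\<^sub>F r in at_top. N \<le> q r"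
        using eventually_ge_at_top[of "real N * k"]
        by eventually_elim (use k in \<open>auto simp: q_def field_simps intro!: le_nat_floor\<close>)
    qed
    have q_ratio: "((\<lambda>r. real (q r) / r) \<longlongrightarrow> 1 / k) at_top"
    proof (rule tendsto_sandwich)
      show "\<forall>\<^sub>F r in at_top. 1 / k - 1 / r \<le> real (q r) / r"
        using eventually_gt_at_top[of 0]
      proof eventually_elim
        case (elim r)
        then have "(r / k - 1) / r \<le> real (q r) / r"
          using q_bounds(1)[OF elim] by (intro divide_right_mono) auto
        then show ?case using elim by (simp add: diff_divide_distrib)
      qed
      show "\<forall>\<^sub>F r in at_top. real (q r) / r \<le> 1 / k"
        using eventually_gt_at_top[of 0]
      proof eventually_elim
        case (elim r)
        then have "real (q r) / r \<le> (r / k) / r"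
          using q_bounds(2)[OF elim] by (intro divide_right_mono) auto
        then show ?case using elim by simp
      qed
      show "((\<lambda>r::real. 1 / k - 1 / r) \<longlongrightarrow> 1 / k) at_top"
        by (rule tendsto_eq_rhs[OF tendsto_diff[OF tendsto_const tendsto_divide_0]])
          (auto simp: filterlim_ident at_top_le_at_infinity intro: filterlim_at_top_imp_at_infinity)
    qed simp
    have "((\<lambda>r. S k (q r) / real (q r) * (real (q r) / r)) \<longlongrightarrow> m k * (1 / k)) at_top"
      by (intro tendsto_mult q_ratio filterlim_compose[OF lim[OF k(1)] q_lim])
    moreover have "C - e < m k * (1 / k)"
      using m(2)[OF k(1)] k by (simp add: field_simps)
    ultimately have "\<forall>\<^sub>F r in at_top. C - e < S k (q r) / real (q r) * (real (q r) / r)"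
      by (rule order_tendstoD(1))
    moreover have q_pos: "\<forall>\<^sub>F r in at_top. 0 < q r"
      by (rule eventually_compose_filterlim[OF eventually_gt_at_top q_lim])
    ultimately have "\<forall>\<^sub>F r in at_top. C - e < W r / r"
      using eventually_gt_at_top[of 0]
    proof eventually_elim
      case (elim r)
      have "S k (q r) \<le> W (real (q r) * k)" by (rule lower[OF k(1)])
      also have "\<dots> \<le> W r"
        using q_bounds(2)[OF elim(3)] k by (intro mono) (auto simp: field_simps)
      finally have "S k (q r) / r \<le> W r / r"
        using elim by (intro divide_right_mono) auto
      then show ?case using elim by simp
    qed
    moreover have "\<forall>\<^sub>F r in at_top. W r / r < C + e"
    proof -
      \<comment> \<open>The added 1 is the cost of the cuts per block; the limit (m k + 1) / k is at
        most C + 1 / k.\<close>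
      have "((\<lambda>r. (S k (Suc (q r)) / real (Suc (q r)) + 1) * (real (q r) / r + 1 / r)) \<longlongrightarrow> (m k + 1) * (1 / k + 0)) at_top"
        by (intro tendsto_mult tendsto_add q_ratio tendsto_const
            filterlim_compose[OF LIMSEQ_Suc[OF lim[OF k(1)]] q_lim] tendsto_divide_0[OF tendsto_const])
          (auto intro: filterlim_at_top_imp_at_infinity filterlim_ident)
      moreover have "(m k + 1) * (1 / k + 0) < C + e"
        using m(1)[OF k(1)] k by (simp add: field_simps)
      ultimately have "\<forall>\<^sub>F r in at_top. (S k (Suc (q r)) / real (Suc (q r)) + 1) * (real (q r) / r + 1 / r) < C + e"
        by (rule order_tendstoD(2))
      then show ?thesis
        using eventually_gt_at_top[of 0]
      proof eventually_elim
        case (elim r)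
        have "W r \<le> W (real (Suc (q r)) * k)"
          using q_bounds(1)[OF elim(2)] elim(2) k by (intro mono) (auto simp: field_simps)
        also have "\<dots> \<le> S k (Suc (q r)) + real (Suc (q r))" by (rule upper[OF k(1)])
        finally have "W r / r \<le> (S k (Suc (q r)) + real (Suc (q r))) / r"
          using elim by (intro divide_right_mono) auto
        also have "\<dots> = (S k (Suc (q r)) / real (Suc (q r)) + 1) * (real (Suc (q r)) / r)"
          by (simp add: distrib_right add_divide_distrib del: of_nat_Suc)
        also have "real (Suc (q r)) / r = real (q r) / r + 1 / r"
          by (simp add: add_divide_distrib)
        finally show ?case using elim(1) by linarith
      qed
    qed
    ultimately show ?thesis by blast
  qed
  show ?thesis
  proof (rule order_tendstoI)
    show "\<forall>\<^sub>F r in at_top. a < W r / r" if "a < C" for a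
      using ev[of "C - a"] that by simp
    show "\<forall>\<^sub>F r in at_top. W r / r < a" if "C < a" for a
      using ev[of "a - C"] that by simp
  qed
qed

section \<open>Self-similar processes with stationary increments\<close>

locale self_similar_process = prob_space +
  fixes X :: "real \<Rightarrow> 'a \<Rightarrow> real" and \<beta> :: real
  assumes X_measurable [measurable]: "0 \<le> t \<Longrightarrow> X t \<in> borel_measurable M"
    and \<beta>_pos: "0 < \<beta>"
    and self_similar: "self_similar M \<beta> X"
    and stationary: "stationary_increments M X"
    and cadlag: "\<omega> \<in> space M \<Longrightarrow> cadlag (\<lambda>t. X t \<omega>)"
begin

abbreviation TV :: "real \<Rightarrow> real \<Rightarrow> real \<Rightarrow> 'a \<Rightarrow> ennreal" where
  "TV c s t \<omega> \<equiv> truncated_variation c (\<lambda>u. X u \<omega>) s t"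

lemma right_continuous_X: "\<omega> \<in> space M \<Longrightarrow> right_continuous (\<lambda>t. X t \<omega>)"
  using cadlag by (auto simp: cadlag_def right_continuous_def)

lemma TV_measurable [measurable]: "0 \<le> c \<Longrightarrow> 0 \<le> s \<Longrightarrow> TV c s t \<in> borel_measurable M"
  by (rule borel_measurable_truncated_variation) (auto intro: right_continuous_X)

text \<open>Scaling values by A powr (-\<beta>) divides the threshold by the same factor. It is
  later used with A powr (-\<beta>) = c, which turns the threshold into 1.\<close>

lemma distr_TV_scaling:
  assumes "0 \<le> c" "0 < A"
  shows "distr M borel (\<lambda>\<omega>. ennreal (A powr - \<beta>) * TV (c / A powr - \<beta>) 0 (A * t) \<omega>)
    = distr M borel (TV c 0 t)"
proof -
  have "distr M borel (\<lambda>\<omega>. truncated_variation c (\<lambda>t. A powr - \<beta> * X (A * t) \<omega>) 0 t)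
      = distr M borel (\<lambda>\<omega>. truncated_variation c (\<lambda>t. X t \<omega>) 0 t)"
  proof (rule distr_truncated_variation_eq1)
    show "right_continuous (\<lambda>t. A powr - \<beta> * X (A * t) \<omega>)" if "\<omega> \<in> space M" for \<omega>
      using right_continuous_mult_const[OF right_continuous_affine[OF right_continuous_X[OF that] \<open>0 < A\<close>, of 0]]
      by simp
  qed (use assms self_similar in \<open>auto simp: self_similar_def intro: right_continuous_X\<close>)
  then show ?thesis
    using assms truncated_variation_affine[of "c / A powr - \<beta>" A "\<lambda>u. X u _" 0 0 t]
    by (simp add: truncated_variation_scale)
qed

text \<open>Stationarity controls only increments, so the paths are compared after subtracting their
  initial values, which leaves the truncated variation unchanged.\<close>

lemma distr_TV_shift_seq:
  fixes s t :: "nat \<Rightarrow> real"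
  assumes "0 \<le> c" "0 < h" "\<And>n. 0 \<le> s n"
  shows "distr M (\<Pi>\<^sub>M n\<in>UNIV. borel) (\<lambda>\<omega> n. TV c (s n + h) (t n + h) \<omega>)
    = distr M (\<Pi>\<^sub>M n\<in>UNIV. borel) (\<lambda>\<omega> n. TV c (s n) (t n) \<omega>)"
proof -
  have "distr M (\<Pi>\<^sub>M n\<in>UNIV. borel) (\<lambda>\<omega> n. truncated_variation c (\<lambda>u. X u \<omega> - X 0 \<omega>) (s n) (t n))
    = distr M (\<Pi>\<^sub>M n\<in>UNIV. borel) (\<lambda>\<omega> n. truncated_variation c (\<lambda>u. X (u + h) \<omega> - X h \<omega>) (s n) (t n))"
  proof (rule distr_truncated_variation_eq)
    show "right_continuous (\<lambda>u. X (u + h) \<omega> - X h \<omega>)" if "\<omega> \<in> space M" for \<omega>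
      using right_continuous_diff_const[OF right_continuous_affine[OF right_continuous_X[OF that], of 1 h]] assms
      by simp
    show "distr M path_space (\<lambda>\<omega>. \<lambda>t\<in>{0..}. X t \<omega> - X 0 \<omega>)
        = distr M path_space (\<lambda>\<omega>. \<lambda>t\<in>{0..}. X (t + h) \<omega> - X h \<omega>)"
      by (rule distr_increments_eq) (use prob_space_axioms stationary assms in auto)
  qed (use assms in \<open>auto intro: right_continuous_diff_const right_continuous_X\<close>)
  then show ?thesis
    using assms truncated_variation_affine[of c 1 "\<lambda>u. X u _" h]
    by (simp add: truncated_variation_diff_const)
qed

lemma distr_eq_imp_nn_integral_eq:
  assumes "f \<in> borel_measurable M" "g \<in> borel_measurable M" "distr M borel f = distr M borel g"
  shows "(\<integral>\<^sup>+\<omega>. f \<omega> \<partial>M) = (\<integral>\<^sup>+\<omega>. g \<omega> \<partial>M)"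
  using nn_integral_distr[OF assms(1), of "\<lambda>x. x"] nn_integral_distr[OF assms(2), of "\<lambda>x. x"] assms(3) by simp

lemma nn_integral_TV_shift:
  assumes "0 \<le> c" "0 \<le> h" "0 \<le> s"
  shows "(\<integral>\<^sup>+\<omega>. TV c (s + h) (t + h) \<omega> \<partial>M) = (\<integral>\<^sup>+\<omega>. TV c s t \<omega> \<partial>M)"
proof (cases "h = 0")
  case False
  \<comment> \<open>A constant sequence of intervals, read off at coordinate 0, reduces the claim to
    the statement about sequences.\<close>
  have seq_meas: "(\<lambda>\<omega> n. TV c (s + r) (t + r) \<omega>) \<in> measurable M (\<Pi>\<^sub>M n\<in>(UNIV :: nat set). borel)" if "0 \<le> r" for r
    by (rule measurable_PiM_single') (use that assms in auto)
  have "(\<lambda>y. y 0) \<in> borel_measurable (\<Pi>\<^sub>M n\<in>(UNIV :: nat set). borel :: ennreal measure)"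
    by measurable
  from distr_comp_eq[OF seq_meas[of h] seq_meas[of 0] _ this] distr_TV_shift_seq[of c h "\<lambda>_. s" "\<lambda>_. t"]
  have "distr M borel (TV c (s + h) (t + h)) = distr M borel (TV c s t)"
    using False assms by simp
  then show ?thesis
    by (rule distr_eq_imp_nn_integral_eq[rotated 2]) (use assms in auto)
qed simp

section \<open>Mean truncated variation at threshold 1 and the law of large numbers\<close>

definition mean_TV :: "real \<Rightarrow> ennreal" where
  "mean_TV t = (\<integral>\<^sup>+\<omega>. TV 1 0 t \<omega> \<partial>M)"

lemma mean_TV_bounds:
  assumes "0 \<le> a"
  shows "of_nat n * mean_TV a \<le> mean_TV (real n * a)"
    and "mean_TV (real n * a) \<le> of_nat n * mean_TV a + of_nat n"
proof -
  have sum: "(\<integral>\<^sup>+\<omega>. (\<Sum>i<n. TV 1 (real i * a) (real (Suc i) * a) \<omega>) \<partial>M) = of_nat n * mean_TV a"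
  proof -
    have "(\<integral>\<^sup>+\<omega>. (\<Sum>i<n. TV 1 (real i * a) (real (Suc i) * a) \<omega>) \<partial>M)
        = (\<Sum>i<n. \<integral>\<^sup>+\<omega>. TV 1 (real i * a) (real (Suc i) * a) \<omega> \<partial>M)"
      by (rule nn_integral_sum) (use assms in auto)
    also have "\<dots> = (\<Sum>i<n. mean_TV a)"
    proof (rule sum.cong[OF refl])
      fix i
      show "(\<integral>\<^sup>+\<omega>. TV 1 (real i * a) (real (Suc i) * a) \<omega> \<partial>M) = mean_TV a"
        using nn_integral_TV_shift[of 1 "real i * a" 0 a] assms
        by (simp add: mean_TV_def distrib_right)
    qed
    finally show ?thesis by simp
  qed
  show "of_nat n * mean_TV a \<le> mean_TV (real n * a)"
    unfolding sum[symmetric] unfolding mean_TV_def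
    by (intro nn_integral_mono sum_truncated_variation_le assms)
  have "mean_TV (real n * a) \<le> (\<integral>\<^sup>+\<omega>. (\<Sum>i<n. TV 1 (real i * a) (real (Suc i) * a) \<omega>) + of_nat n \<partial>M)"
    unfolding mean_TV_def by (intro nn_integral_mono truncated_variation_le_sum assms)
  also have "\<dots> = of_nat n * mean_TV a + of_nat n"
    using assms by (subst nn_integral_add) (auto simp: sum emeasure_space_1 simp del: of_nat_Suc)
  finally show "mean_TV (real n * a) \<le> of_nat n * mean_TV a + of_nat n" .
qed

text \<open>Scaling turns threshold c on [0, 1] into threshold 1 on [0, A]. As A may be smaller than
  t, finitely many blocks of length A are then put together.\<close>

lemma mean_TV_finite:
  assumes "0 < c" "(\<integral>\<^sup>+\<omega>. TV c 0 1 \<omega> \<partial>M) < \<infinity>"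
  shows "mean_TV t < \<infinity>"
proof -
  define A where "A = c powr (- 1 / \<beta>)"
  have A: "0 < A" "A powr - \<beta> = c"
    using assms(1) \<beta>_pos by (simp_all add: A_def powr_powr)
  have "distr M borel (\<lambda>\<omega>. ennreal c * TV 1 0 A \<omega>) = distr M borel (TV c 0 1)"
    using distr_TV_scaling[of c A 1] A assms(1) by simp
  then have "(\<integral>\<^sup>+\<omega>. ennreal c * TV 1 0 A \<omega> \<partial>M) = (\<integral>\<^sup>+\<omega>. TV c 0 1 \<omega> \<partial>M)"
    by (rule distr_eq_imp_nn_integral_eq[rotated 2]) (use assms in auto)
  then have "ennreal c * mean_TV A < \<infinity>"
    using assms(2) unfolding mean_TV_def by (subst nn_integral_cmult[symmetric]) auto
  then have A_finite: "mean_TV A < \<infinity>"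
    using assms(1) by (auto simp: ennreal_mult_less_top)
  obtain n :: nat where "t / A \<le> real n" using real_arch_simple by blast
  then have "t \<le> real n * A" using A by (simp add: pos_divide_le_eq)
  then have "mean_TV t \<le> mean_TV (real n * A)"
    unfolding mean_TV_def by (intro nn_integral_mono truncated_variation_mono) auto
  also have "\<dots> \<le> of_nat n * mean_TV A + of_nat n"
    using A by (intro mean_TV_bounds) auto
  also have "\<dots> < \<infinity>"
    using A_finite by (simp add: ennreal_mult_less_top of_nat_less_top)
  finally show ?thesis .
qed

text \<open>Birkhoff's theorem is applied to the shift on sequence space under the law
  \<open>N\<close> of the block sequence, with the zeroth coordinate as observable, and the result
  is pulled back along \<open>Y\<close>.\<close>

lemma law_of_large_numbers:
  assumes finite: "mean_TV (real k) < \<infinity>" and k: "1 \<le> k"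
    and erg: "ergodic_seq M (\<lambda>n \<omega>. TV 1 (real (n * k)) (real (Suc n * k)) \<omega>)"
  shows "AE \<omega> in M. (\<lambda>n. (\<Sum>i<n. enn2real (TV 1 (real (i * k)) (real (Suc i * k)) \<omega>)) / real n)
    \<longlonglongrightarrow> enn2real (mean_TV (real k))"
proof -
  define Y where "Y \<omega> n = TV 1 (real (n * k)) (real (Suc n * k)) \<omega>" for \<omega> n
  let ?S = "\<Pi>\<^sub>M n\<in>(UNIV :: nat set). (borel :: ennreal measure)"
  define N where "N = distr M ?S Y"
  define T where "T = (\<lambda>(y :: nat \<Rightarrow> ennreal) n. y (Suc n))"
  have Y_meas [measurable]: "Y \<in> measurable M ?S"
    unfolding Y_def by (rule measurable_PiM_single') auto
  have T_meas [measurable]: "T \<in> measurable ?S ?S"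
    unfolding T_def by (rule measurable_PiM_single') auto
  have [measurable_cong]: "sets N = sets ?S" by (simp add: N_def)
  have space_N: "space N = UNIV" by (simp add: N_def space_PiM)
  \<comment> \<open>Dropping the first block amounts to shifting time by k.\<close>
  have "distr M ?S (\<lambda>\<omega>. T (Y \<omega>)) = distr M ?S Y"
    using distr_TV_shift_seq[of 1 "real k" "\<lambda>n. real (n * k)" "\<lambda>n. real (Suc n * k)"] k
    by (simp add: T_def Y_def[abs_def] algebra_simps)
  then have "distr N N T = N"
    unfolding N_def by (subst distr_distr) (simp_all add: comp_def cong: distr_cong)
  have "ergodic N T"
  proof (intro ergodic.intro measure_preserving.intro measure_preserving_axioms.intro ergodic_axioms.intro)
    show "prob_space N" unfolding N_def by (rule prob_space_distr) simp
    show "T \<in> measurable N N" by simp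
    show "distr N N T = N" by fact
    fix B assume B: "B \<in> sets N" "T -` B \<inter> space N = B"
    then have "B \<in> sets ?S" "(\<lambda>y n. y (Suc n)) -` B = B"
      by (simp_all add: N_def T_def space_PiM)
    then have "measure M {\<omega> \<in> space M. Y \<omega> \<in> B} \<in> {0, 1}"
      using erg unfolding ergodic_seq_def Y_def by blast
    moreover have "{\<omega> \<in> space M. Y \<omega> \<in> B} = Y -` B \<inter> space M" by auto
    ultimately show "measure N B \<in> {0, 1}"
      using B by (simp add: N_def measure_distr)
  qed
  have mean: "(\<integral>\<^sup>+\<omega>. Y \<omega> 0 \<partial>M) = mean_TV (real k)"
    by (simp add: Y_def mean_TV_def)
  have Y0_meas: "(\<lambda>\<omega>. Y \<omega> 0) \<in> borel_measurable M" by measurable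
  \<comment> \<open>\<open>enn2real\<close> sends \<infinity> to 0; since the value \<infinity> has
    probability 0, the mean is unchanged.\<close>
  have "AE \<omega> in M. Y \<omega> 0 \<noteq> \<infinity>"
    using nn_integral_PInf_AE[OF Y0_meas] mean finite by simp
  then have "AE \<omega> in M. ennreal (enn2real (Y \<omega> 0)) = Y \<omega> 0"
    by eventually_elim (simp add: less_top)
  then have mean': "(\<integral>\<^sup>+\<omega>. ennreal (enn2real (Y \<omega> 0)) \<partial>M) = mean_TV (real k)"
    unfolding mean[symmetric] by (rule nn_integral_cong_AE)
  have int: "integrable M (\<lambda>\<omega>. enn2real (Y \<omega> 0))"
    by (rule integrableI_nonneg) (use mean' finite in auto)
  have eval: "(\<lambda>y. enn2real (y 0)) \<in> borel_measurable ?S" by measurable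
  have "integrable N (\<lambda>y. enn2real (y 0))"
    unfolding N_def using int by (subst integrable_distr_eq[OF Y_meas eval])
  then have "AE y in N. (\<lambda>n. (\<Sum>i<n. enn2real ((T ^^ i) y 0)) / real n) \<longlonglongrightarrow> (\<integral>y. enn2real (y 0) \<partial>N)"
    by (rule ergodic.birkhoff[OF \<open>ergodic N T\<close>])
  moreover have "(T ^^ i) y n = y (n + i)" for i y n
    by (induction i arbitrary: n) (simp_all add: T_def)
  moreover have "(\<integral>y. enn2real (y 0) \<partial>N) = enn2real (mean_TV (real k))"
    unfolding N_def integral_distr[OF Y_meas eval]
    by (subst integral_eq_nn_integral) (use mean' in auto)
  ultimately have "AE y in N. (\<lambda>n. (\<Sum>i<n. enn2real (y i)) / real n) \<longlonglongrightarrow> enn2real (mean_TV (real k))"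
    by simp
  from AE_distrD[OF Y_meas this[unfolded N_def]] show ?thesis by (simp add: Y_def)
qed

text \<open>Once |X t - X 0| \<le> 1 for all t, use that for every r > 0 the variable X t has the
  law of X (A * t) / r with A = r powr (1 / \<beta>). This quotient is at most (|X 0| + 1) / r in
  absolute value, whatever A is, and r \<longrightarrow> \<infinity> leaves only X t = 0.\<close>

lemma AE_zero_if_mean_TV_zero:
  assumes zero: "\<And>k::nat. 1 \<le> k \<Longrightarrow> mean_TV (real k) = 0"
  shows "AE \<omega> in M. \<forall>t\<ge>0. X t \<omega> = 0"
proof -
  have "AE \<omega> in M. TV 1 0 (real (Suc k)) \<omega> = 0" for k
    using zero[of "Suc k"] by (simp add: mean_TV_def nn_integral_0_iff_AE del: of_nat_Suc)
  then have "AE \<omega> in M. \<forall>k. TV 1 0 (real (Suc k)) \<omega> = 0"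
    by (simp add: AE_all_countable)
  then have bounded: "AE \<omega> in M. \<forall>t\<ge>0. \<bar>X t \<omega> - X 0 \<omega>\<bar> \<le> 1"
  proof (rule AE_mp, intro AE_I2 impI allI)
    fix \<omega> t assume *: "\<forall>k. TV 1 0 (real (Suc k)) \<omega> = 0" "(0::real) \<le> t"
    obtain n where "t \<le> real n" using real_arch_simple by blast
    then have "ennreal (\<bar>X t \<omega> - X 0 \<omega>\<bar> - 1) \<le> TV 1 0 (real (Suc n)) \<omega>"
      using * by (intro truncated_variation_ge_increment) auto
    then show "\<bar>X t \<omega> - X 0 \<omega>\<bar> \<le> 1" using *(1) by (simp add: ennreal_eq_0_iff del: of_nat_Suc)
  qed
  have null: "prob {\<omega> \<in> space M. \<bar>X t \<omega>\<bar> > \<epsilon>} = 0" if t: "0 \<le> t" and "0 < \<epsilon>" for t \<epsilon>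
  proof -
    let ?Z = "\<lambda>r \<omega>. (\<bar>X 0 \<omega>\<bar> + 1) / r"
    have le: "prob {\<omega> \<in> space M. \<bar>X t \<omega>\<bar> > \<epsilon>} \<le> prob {\<omega> \<in> space M. \<bar>?Z r \<omega> - 0\<bar> > \<epsilon>}" if "0 < r" for r
    proof -
      define A where "A = r powr (1 / \<beta>)"
      have A: "0 < A" "A powr - \<beta> = 1 / r"
        using \<open>0 < r\<close> \<beta>_pos by (simp_all add: A_def powr_powr powr_minus divide_inverse)
      have eval: "(\<lambda>x. x t) \<in> borel_measurable path_space"
        using t by (intro measurable_component_singleton) auto
      have "distr M borel (\<lambda>\<omega>. (\<lambda>t\<in>{0..}. A powr - \<beta> * X (A * t) \<omega>) t)
          = distr M borel (\<lambda>\<omega>. (\<lambda>t\<in>{0..}. X t \<omega>) t)"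
      proof (rule distr_comp_eq[OF measurable_path measurable_path _ eval])
        show "distr M path_space (\<lambda>\<omega>. \<lambda>t\<in>{0..}. A powr - \<beta> * X (A * t) \<omega>)
            = distr M path_space (\<lambda>\<omega>. \<lambda>t\<in>{0..}. X t \<omega>)"
          using self_similar A(1) unfolding self_similar_def by blast
      qed (use A(1) in auto)
      then have law: "distr M borel (\<lambda>\<omega>. X (A * t) \<omega> / r) = distr M borel (X t)"
        using t A by simp
      have "prob {\<omega> \<in> space M. \<bar>X t \<omega>\<bar> > \<epsilon>} = measure (distr M borel (X t)) {x. \<bar>x\<bar> > \<epsilon>}"
        using t by (subst measure_distr) (auto intro!: arg_cong[where f = prob])
      also have "\<dots> = prob {\<omega> \<in> space M. \<bar>X (A * t) \<omega> / r\<bar> > \<epsilon>}"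
        unfolding law[symmetric] using t A by (subst measure_distr) (auto intro!: arg_cong[where f = prob])
      also have "\<dots> \<le> prob {\<omega> \<in> space M. \<bar>?Z r \<omega> - 0\<bar> > \<epsilon>}"
      proof (rule finite_measure_mono_AE)
        show "AE \<omega> in M. \<omega> \<in> {\<omega> \<in> space M. \<bar>X (A * t) \<omega> / r\<bar> > \<epsilon>} \<longrightarrow> \<omega> \<in> {\<omega> \<in> space M. \<bar>?Z r \<omega> - 0\<bar> > \<epsilon>}"
          using bounded
        proof eventually_elim
          case (elim \<omega>)
          then have "\<bar>X (A * t) \<omega> - X 0 \<omega>\<bar> \<le> 1" using A t by simp
          then have "\<bar>X (A * t) \<omega>\<bar> / r \<le> ?Z r \<omega>"
            using \<open>0 < r\<close> by (intro divide_right_mono) linarith+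
          then show ?case using \<open>0 < r\<close> by (auto simp: abs_divide)
        qed
      qed measurable
      finally show ?thesis .
    qed
    have "((\<lambda>r. prob {\<omega> \<in> space M. \<bar>?Z r \<omega> - 0\<bar> > \<epsilon>}) \<longlongrightarrow> 0) at_top"
    proof (rule AE_tendsto_imp_prob_tendsto_0[OF _ _ \<open>0 < \<epsilon>\<close>])
      show "AE \<omega> in M. ((\<lambda>r. ?Z r \<omega>) \<longlongrightarrow> 0) at_top"
        by (intro AE_I2 tendsto_divide_0[OF tendsto_const] filterlim_at_top_imp_at_infinity filterlim_ident)
    qed measurable
    then have "prob {\<omega> \<in> space M. \<bar>X t \<omega>\<bar> > \<epsilon>} \<le> 0"
      by (rule tendsto_lowerbound)
        (rule eventually_mono[OF eventually_gt_at_top[of 0] le], assumption, simp)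
    then show ?thesis by (simp add: measure_le_0_iff)
  qed
  have "AE \<omega> in M. X t \<omega> = 0" if t: "0 \<le> t" for t
  proof -
    have "AE \<omega> in M. \<not> \<bar>X t \<omega>\<bar> > inverse (real (Suc n))" for n
    proof -
      have "{\<omega> \<in> space M. \<bar>X t \<omega>\<bar> > inverse (real (Suc n))} \<in> events"
        using t by measurable
      then show ?thesis
        using null[OF t, of "inverse (real (Suc n))"] by (simp add: prob_Collect_eq_0 del: of_nat_Suc)
    qed
    then have "AE \<omega> in M. \<forall>n. \<not> \<bar>X t \<omega>\<bar> > inverse (real (Suc n))"
      by (simp add: AE_all_countable)
    then show ?thesis
    proof (rule AE_mp, intro AE_I2 impI)
      fix \<omega> assume "\<forall>n. \<not> \<bar>X t \<omega>\<bar> > inverse (real (Suc n))"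
      then show "X t \<omega> = 0" using reals_Archimedean[of "\<bar>X t \<omega>\<bar>"] by auto
    qed
  qed
  \<comment> \<open>The null set depends on the time; rational times share one, and right continuity
    covers the other times.\<close>
  then have "AE \<omega> in M. \<forall>q\<in>\<rat> \<inter> {0..}. X q \<omega> = 0"
    by (subst AE_ball_countable) (auto intro: countable_Int1 countable_rat)
  then show ?thesis
  proof (rule AE_mp, intro AE_I2 impI allI)
    fix \<omega> t assume \<omega>: "\<omega> \<in> space M" and q: "\<forall>q\<in>\<rat> \<inter> {0..}. X q \<omega> = 0" and t: "(0::real) \<le> t"
    show "X t \<omega> = 0"
    proof (rule ccontr)
      assume "X t \<omega> \<noteq> 0"
      moreover have "((\<lambda>t. X t \<omega>) \<longlongrightarrow> X t \<omega>) (at_right t)"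
        using right_continuous_X[OF \<omega>] t by (simp add: right_continuous_def)
      ultimately have "\<forall>\<^sub>F u in at_right t. X u \<omega> \<noteq> 0"
        using tendsto_imp_eventually_ne by blast
      then obtain b where b: "t < b" "\<And>u. t < u \<Longrightarrow> u < b \<Longrightarrow> X u \<omega> \<noteq> 0"
        by (auto simp: eventually_at_right_field)
      obtain p where "p \<in> \<rat>" "t < p" "p < b"
        using Rats_dense_in_real[OF \<open>t < b\<close>] by blast
      then show False using q t b(2)[of p] by auto
    qed
  qed
qed

end

text \<open>The hypothesis \<open>nontrivial\<close> excludes the zero process: it satisfies all the
  other hypotheses, but its limit is 0, so no C > 0 would serve.\<close>

theorem theorem2p5:
  fixes M :: "'a measure" and X :: "real \<Rightarrow> 'a \<Rightarrow> real" and \<beta> c\<^sub>0 :: real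
  assumes "prob_space M"
    and "\<And>t. 0 \<le> t \<Longrightarrow> X t \<in> borel_measurable M"
    and "0 < \<beta>"
    and "self_similar M \<beta> X"
    and "stationary_increments M X"
    and "\<And>\<omega>. \<omega> \<in> space M \<Longrightarrow> cadlag (\<lambda>t. X t \<omega>)"
    and nontrivial: "\<not> (AE \<omega> in M. \<forall>t\<ge>0. X t \<omega> = 0)"
    and "0 < c\<^sub>0"
    and "(\<integral>\<^sup>+ \<omega>. truncated_variation c\<^sub>0 (\<lambda>t. X t \<omega>) 0 1 \<partial>M) < \<infinity>"
    and "\<And>k::nat. 1 \<le> k \<Longrightarrow>
           ergodic_seq M (\<lambda>n \<omega>. truncated_variation 1 (\<lambda>t. X t \<omega>) (real (n * k)) (real (Suc n * k)))"
  shows "\<exists>C::real. 0 < C \<and>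
           (\<forall>t\<ge>0. tendsto_in_probability M
              (\<lambda>c \<omega>. ereal (c powr (1 / \<beta> - 1)) * enn2ereal (truncated_variation c (\<lambda>t. X t \<omega>) 0 t))
              (C * t) (at_right 0))"
proof -
  interpret self_similar_process M X \<beta>
    using assms(1-6) by (simp add: self_similar_process_def self_similar_process_axioms_def)
  have finite: "mean_TV t < \<infinity>" for t
    using mean_TV_finite[OF assms(8,9)] .
  define m where "m k = enn2real (mean_TV (real k))" for k :: nat
  have mean_eq: "mean_TV (real k) = ennreal (m k)" for k
    using finite[of "real k"] by (simp add: m_def)
  have m_nonneg: "0 \<le> m k" for k by (simp add: m_def)
  have "real n * m k \<le> m (n * k)" "m (n * k) \<le> real n * m k + real n" for n k
    using mean_TV_bounds[of "real k" n] m_nonneg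
    by (simp_all add: mean_eq flip: of_nat_mult ennreal_of_nat_eq_real_of_nat)
      (simp_all add: ennreal_of_nat_eq_real_of_nat flip: ennreal_mult ennreal_plus)
  then obtain C where C: "\<And>k. 1 \<le> k \<Longrightarrow> m k \<le> real k * C" "\<And>k. 1 \<le> k \<Longrightarrow> real k * C \<le> m k + 1"
    using ex_almost_additive_rate[of m] by blast
  have "0 < C"
  proof -
    obtain k :: nat where k: "1 \<le> k" "mean_TV (real k) \<noteq> 0"
      using AE_zero_if_mean_TV_zero nontrivial by blast
    then have "0 < real k * C"
      using C(1)[OF k(1)] m_nonneg[of k] mean_eq[of k] by (cases "m k = 0") auto
    then show ?thesis by (simp add: zero_less_mult_iff)
  qed
  define W where "W t \<omega> = enn2real (TV 1 0 t \<omega>)" for t \<omega>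
  have W_meas [measurable]: "W t \<in> borel_measurable M" for t
    unfolding W_def by measurable
  have "AE \<omega> in M. TV 1 0 (real n) \<omega> \<noteq> \<infinity>" for n
    using nn_integral_PInf_AE[of "TV 1 0 (real n)" M] finite[of "real n"] by (simp add: mean_TV_def)
  then have "AE \<omega> in M. \<forall>n. TV 1 0 (real n) \<omega> \<noteq> \<infinity>"
    by (simp add: AE_all_countable)
  \<comment> \<open>Monotonicity spreads finiteness from the intervals [0, n] to all intervals,
    outside one null set; there \<open>W\<close> loses nothing by using
    \<open>enn2real\<close>.\<close>
  then have TV_finite: "AE \<omega> in M. \<forall>s\<ge>0. \<forall>t. TV 1 s t \<omega> < \<infinity>"
  proof (rule AE_mp, intro AE_I2 impI allI)
    fix \<omega> s t assume *: "\<forall>n. TV 1 0 (real n) \<omega> \<noteq> \<infinity>" "(0::real) \<le> s"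
    obtain n where "t \<le> real n" using real_arch_simple by blast
    then have "TV 1 s t \<omega> \<le> TV 1 0 (real n) \<omega>"
      using *(2) by (intro truncated_variation_mono) auto
    then show "TV 1 s t \<omega> < \<infinity>" using *(1) by (metis infinity_ennreal_def less_top top.extremum_unique)
  qed
  \<comment> \<open>One null set for all k is needed, since the block length will depend on the
    precision.\<close>
  have "AE \<omega> in M. \<forall>k. 1 \<le> k \<longrightarrow>
      (\<lambda>n. (\<Sum>i<n. enn2real (TV 1 (real (i * k)) (real (Suc i * k)) \<omega>)) / real n) \<longlonglongrightarrow> m k"
    unfolding AE_all_countable m_def using law_of_large_numbers[OF finite _ assms(10)] by auto
  with TV_finite have lim: "AE \<omega> in M. ((\<lambda>r. W r \<omega> / r) \<longlongrightarrow> C) at_top"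
  proof eventually_elim
    case (elim \<omega>)
    have TV_W: "TV 1 0 t \<omega> = ennreal (W t \<omega>)" for t
      using elim(1) by (simp add: W_def)
    define S where "S k n = (\<Sum>i<n. enn2real (TV 1 (real (i * k)) (real (Suc i * k)) \<omega>))" for k n
    have S: "(\<Sum>i<n. TV 1 (real i * real k) (real (Suc i) * real k) \<omega>) = ennreal (S k n)" for k n
      using elim(1) unfolding S_def by (subst sum_ennreal[symmetric]) (simp_all del: of_nat_Suc mult_Suc)
    show ?case
    proof (rule tendsto_average_at_top[where S = S and m = m])
      show "W s \<omega> \<le> W t \<omega>" if "0 \<le> s" "s \<le> t" for s t
        using truncated_variation_mono[of 1 0 0 s t "\<lambda>u. X u \<omega>"] that unfolding TV_W by (simp add: W_def)
      show "S k n \<le> W (real n * real k) \<omega>" for k n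
        using sum_truncated_variation_le[of "real k" "\<lambda>u. X u \<omega>" n] unfolding S TV_W by (simp add: W_def)
      show "W (real n * real k) \<omega> \<le> S k n + real n" for k n
      proof -
        have "0 \<le> S k n" by (simp add: S_def sum_nonneg)
        then show ?thesis
          using truncated_variation_le_sum[of "real k" "\<lambda>u. X u \<omega>" n] unfolding S TV_W
          by (simp add: ennreal_of_nat_eq_real_of_nat flip: ennreal_plus)
      qed
    qed (use elim(2) C in \<open>auto simp: S_def\<close>)
  qed
  have "tendsto_in_probability M (\<lambda>c \<omega>. ereal (c powr (1 / \<beta> - 1)) * enn2ereal (TV c 0 t \<omega>)) (C * t) (at_right 0)"
    if "0 \<le> t" for t
  proof (cases "t = 0")
    \<comment> \<open>For t = 0 the rescaled horizon A * t does not grow, so the limit at large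
      times says nothing; the variation over a point is 0.\<close>
    case True
    have "\<forall>\<^sub>F c in at_right 0. measure M {\<omega> \<in> space M.
        \<bar>ereal (c powr (1 / \<beta> - 1)) * enn2ereal (TV c 0 0 \<omega>) - ereal 0\<bar> > ereal \<epsilon>} = 0" if "0 < \<epsilon>" for \<epsilon>
      using eventually_at_right_less[of 0]
      by eventually_elim (use that in \<open>simp add: truncated_variation_self zero_ennreal.rep_eq\<close>)
    then show ?thesis
      unfolding True tendsto_in_probability_def by (auto intro: tendsto_eventually)
  next
    case False
    then have t: "0 < t" using that by simp
    show ?thesis unfolding tendsto_in_probability_def
    proof (intro allI impI)
      fix \<epsilon> :: real assume "0 < \<epsilon>"
      \<comment> \<open>The deviation to be bounded becomes t * (W (A * t) / (A * t) - C), hence the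
        tolerance \<epsilon> / t.\<close>
      let ?p = "\<lambda>r. prob {\<omega> \<in> space M. \<bar>W r \<omega> / r - C\<bar> > \<epsilon> / t}"
      have eq: "measure M {\<omega> \<in> space M. \<bar>ereal (c powr (1 / \<beta> - 1)) * enn2ereal (TV c 0 t \<omega>) - ereal (C * t)\<bar> > ereal \<epsilon>}
          = ?p (c powr (- 1 / \<beta>) * t)" if c: "0 < c" for c
      proof -
        define A where "A = c powr (- 1 / \<beta>)"
        have A: "0 < A" "A powr - \<beta> = c"
          using c \<beta>_pos by (simp_all add: A_def powr_powr)
        have A_inv: "c powr (1 / \<beta> - 1) * c = 1 / A"
          using c by (simp add: A_def powr_diff powr_minus_divide flip: minus_divide_left)
        \<comment> \<open>Written as membership in a Borel set of values, the event has a
          probability that depends only on the law of \<open>TV c 0 t\<close>.\<close>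
        define B where "B = {y. \<bar>ereal (c powr (1 / \<beta> - 1)) * enn2ereal y - ereal (C * t)\<bar> > ereal \<epsilon>}"
        have B: "B \<in> sets borel" unfolding B_def by measurable
        have law: "distr M borel (\<lambda>\<omega>. ennreal c * TV 1 0 (A * t) \<omega>) = distr M borel (TV c 0 t)"
          using distr_TV_scaling[of c A t] A c by simp
        have "measure M {\<omega> \<in> space M. TV c 0 t \<omega> \<in> B} = measure (distr M borel (TV c 0 t)) B"
          using c B by (subst measure_distr) (auto intro!: arg_cong[where f = prob])
        also have "\<dots> = prob {\<omega> \<in> space M. ennreal c * TV 1 0 (A * t) \<omega> \<in> B}"
          unfolding law[symmetric] using B by (subst measure_distr) (auto intro!: arg_cong[where f = prob])
        also have "\<dots> = ?p (A * t)"
        proof (rule measure_eq_AE)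
          show "AE \<omega> in M. \<omega> \<in> {\<omega> \<in> space M. ennreal c * TV 1 0 (A * t) \<omega> \<in> B}
              \<longleftrightarrow> \<omega> \<in> {\<omega> \<in> space M. \<bar>W (A * t) \<omega> / (A * t) - C\<bar> > \<epsilon> / t}"
            using TV_finite
          proof eventually_elim
            case (elim \<omega>)
            then have "ennreal c * TV 1 0 (A * t) \<omega> = ennreal (c * W (A * t) \<omega>)"
              using c by (simp add: W_def ennreal_mult)
            moreover have "0 \<le> c * W (A * t) \<omega>" using c by (simp add: W_def)
            ultimately have "enn2ereal (ennreal c * TV 1 0 (A * t) \<omega>) = ereal (c * W (A * t) \<omega>)"
              by (simp add: enn2ereal_ennreal)
            moreover have "c powr (1 / \<beta> - 1) * (c * W (A * t) \<omega>) - C * t = t * (W (A * t) \<omega> / (A * t) - C)"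
              using A_inv t by (simp add: mult.assoc[symmetric]) (simp add: field_simps)
            ultimately show ?case
              using t by (simp add: B_def abs_mult pos_divide_less_eq mult.commute)
          qed
        qed (use B in measurable)
        finally show ?thesis by (simp add: A_def B_def)
      qed
      have "filterlim (\<lambda>c::real. c powr (- 1 / \<beta>)) at_top (at_right 0)"
        using \<beta>_pos by real_asymp
      then have "filterlim (\<lambda>c. c powr (- 1 / \<beta>) * t) at_top (at_right 0)"
        using t by (simp add: filterlim_at_top_mult_tendsto_pos[OF tendsto_const])
      moreover have "(?p \<longlongrightarrow> 0) at_top"
        by (rule AE_tendsto_imp_prob_tendsto_0) (use lim \<open>0 < \<epsilon>\<close> t in auto)
      ultimately have "((\<lambda>c. ?p (c powr (- 1 / \<beta>) * t)) \<longlongrightarrow> 0) (at_right 0)"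
        by (rule filterlim_compose[rotated])
      then show "((\<lambda>c. measure M {\<omega> \<in> space M.
          \<bar>ereal (c powr (1 / \<beta> - 1)) * enn2ereal (TV c 0 t \<omega>) - ereal (C * t)\<bar> > ereal \<epsilon>}) \<longlongrightarrow> 0) (at_right 0)"
        by (rule Lim_transform_eventually)
          (use eventually_at_right_less[of 0] in \<open>eventually_elim, simp add: eq\<close>)
    qed
  qed
  then show ?thesis using \<open>0 < C\<close> by blast
qed

end
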